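(* There exists a quasi-abelian category that is not integral and in which there exists a universal monomorphism that is not strict.
   Context: An additive category is preabelian if every morphism has a kernel and a cokernel. In a preabelian category each morphism $f$ factors canonically as $f=(\operatorname{im} f)\circ \overline{f}\circ(\operatorname{coim} f)$, where $\operatorname{coim} f=\operatorname{coker}(\ker f)$, $\operatorname{im} f=\ker(\operatorname{coker} f)$ and $\overline{f}\colon \operatorname{Coim} f\to\operatorname{Im} f$; $f$ is strict if $\overline{f}$ is an isomorphism. A monomorphism is strict if and only if it is a kernel of some morphism. A preabelian category is quasi-abelian if cokernels (morphisms that are a cokernel of some morphism) are stable under pullback and kernels (morphisms that are a kernel of some morphism) are stable under pushout. It is integral if epimorphisms are stable under pullback and monomorphisms are stable under pushout. A universal monomorphism is a monomorphism $f\colon A\to B$ such that for every morphism $g\colon A\to X$ the morphism $f'\colon X\to X\sqcup_A B$ in the pushout square of $f$ and $g$ is a monomorphism. *)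

theory Defs
  imports Complex_Main "HOL-Algebra.Group"
begin

section \<open>Categories\<close>

record ('o, 'm) cat =
  Ob :: "'o set"
  Arr :: "'m set"
  Dom :: "'m \<Rightarrow> 'o"
  Cod :: "'m \<Rightarrow> 'o"
  Id :: "'o \<Rightarrow> 'm"
  Comp :: "'m \<Rightarrow> 'm \<Rightarrow> 'm"  (infixr \<open>\<cdot>\<index>\<close> 70)

definition Hom :: "('o, 'm, 'r) cat_scheme \<Rightarrow> 'o \<Rightarrow> 'o \<Rightarrow> 'm set" where
  "Hom C X Y = {f \<in> Arr C. Dom C f = X \<and> Cod C f = Y}"

locale category =
  fixes C :: "('o, 'm, 'r) cat_scheme" (structure)
  assumes Dom_Ob: "f \<in> Arr C \<Longrightarrow> Dom C f \<in> Ob C"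
    and Cod_Ob: "f \<in> Arr C \<Longrightarrow> Cod C f \<in> Ob C"
    and Id_Hom: "X \<in> Ob C \<Longrightarrow> Id C X \<in> Hom C X X"
    and Comp_Hom: "f \<in> Hom C X Y \<Longrightarrow> g \<in> Hom C Y Z \<Longrightarrow> g \<cdot> f \<in> Hom C X Z"
    and Comp_Id: "f \<in> Hom C X Y \<Longrightarrow> f \<cdot> Id C X = f"
    and Id_Comp: "f \<in> Hom C X Y \<Longrightarrow> Id C Y \<cdot> f = f"
    and Comp_assoc: "f \<in> Hom C W X \<Longrightarrow> g \<in> Hom C X Y \<Longrightarrow> h \<in> Hom C Y Z
      \<Longrightarrow> (h \<cdot> g) \<cdot> f = h \<cdot> (g \<cdot> f)"

definition mono_arr :: "('o, 'm, 'r) cat_scheme \<Rightarrow> 'm \<Rightarrow> bool" where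
  "mono_arr C f \<longleftrightarrow> f \<in> Arr C \<and>
    (\<forall>T. \<forall>u\<in>Hom C T (Dom C f). \<forall>v\<in>Hom C T (Dom C f). f \<cdot>\<^bsub>C\<^esub> u = f \<cdot>\<^bsub>C\<^esub> v \<longrightarrow> u = v)"

definition epi_arr :: "('o, 'm, 'r) cat_scheme \<Rightarrow> 'm \<Rightarrow> bool" where
  "epi_arr C f \<longleftrightarrow> f \<in> Arr C \<and>
    (\<forall>T. \<forall>u\<in>Hom C (Cod C f) T. \<forall>v\<in>Hom C (Cod C f) T. u \<cdot>\<^bsub>C\<^esub> f = v \<cdot>\<^bsub>C\<^esub> f \<longrightarrow> u = v)"

definition iso_arr :: "('o, 'm, 'r) cat_scheme \<Rightarrow> 'm \<Rightarrow> bool" where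
  "iso_arr C f \<longleftrightarrow> f \<in> Arr C \<and>
    (\<exists>g\<in>Hom C (Cod C f) (Dom C f). g \<cdot>\<^bsub>C\<^esub> f = Id C (Dom C f) \<and> f \<cdot>\<^bsub>C\<^esub> g = Id C (Cod C f))"

text \<open>
  \<open>pullback_square C f g f' g'\<close>: the square
  P --g'--> A,  P --f'--> X,  A --f--> B,  X --g--> B
  is a pullback, so \<open>f'\<close> is the pullback of \<open>f\<close> along \<open>g\<close>.
\<close>

definition pullback_square :: "('o, 'm, 'r) cat_scheme \<Rightarrow> 'm \<Rightarrow> 'm \<Rightarrow> 'm \<Rightarrow> 'm \<Rightarrow> bool" where
  "pullback_square C f g f' g' \<longleftrightarrow>
    f \<in> Arr C \<and> g \<in> Arr C \<and> Cod C f = Cod C g \<and>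
    (\<exists>P\<in>Ob C. f' \<in> Hom C P (Dom C g) \<and> g' \<in> Hom C P (Dom C f) \<and>
      f \<cdot>\<^bsub>C\<^esub> g' = g \<cdot>\<^bsub>C\<^esub> f' \<and>
      (\<forall>T\<in>Ob C. \<forall>a\<in>Hom C T (Dom C f). \<forall>b\<in>Hom C T (Dom C g).
        f \<cdot>\<^bsub>C\<^esub> a = g \<cdot>\<^bsub>C\<^esub> b \<longrightarrow>
        (\<exists>!t. t \<in> Hom C T P \<and> g' \<cdot>\<^bsub>C\<^esub> t = a \<and> f' \<cdot>\<^bsub>C\<^esub> t = b)))"

text \<open>
  \<open>pushout_square C f g f' g'\<close>: the square
  A --f--> B,  A --g--> X,  B --g'--> P,  X --f'--> P
  is a pushout, so \<open>f'\<close> is the pushout of \<open>f\<close> along \<open>g\<close>.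
\<close>

definition pushout_square :: "('o, 'm, 'r) cat_scheme \<Rightarrow> 'm \<Rightarrow> 'm \<Rightarrow> 'm \<Rightarrow> 'm \<Rightarrow> bool" where
  "pushout_square C f g f' g' \<longleftrightarrow>
    f \<in> Arr C \<and> g \<in> Arr C \<and> Dom C f = Dom C g \<and>
    (\<exists>P\<in>Ob C. f' \<in> Hom C (Cod C g) P \<and> g' \<in> Hom C (Cod C f) P \<and>
      g' \<cdot>\<^bsub>C\<^esub> f = f' \<cdot>\<^bsub>C\<^esub> g \<and>
      (\<forall>T\<in>Ob C. \<forall>a\<in>Hom C (Cod C f) T. \<forall>b\<in>Hom C (Cod C g) T.
        a \<cdot>\<^bsub>C\<^esub> f = b \<cdot>\<^bsub>C\<^esub> g \<longrightarrow>
        (\<exists>!t. t \<in> Hom C P T \<and> t \<cdot>\<^bsub>C\<^esub> g' = a \<and> t \<cdot>\<^bsub>C\<^esub> f' = b)))"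

definition universal_mono :: "('o, 'm, 'r) cat_scheme \<Rightarrow> 'm \<Rightarrow> bool" where
  "universal_mono C f \<longleftrightarrow> mono_arr C f \<and>
    (\<forall>g f' g'. pushout_square C f g f' g' \<longrightarrow> mono_arr C f')"


section \<open>Additive and preabelian categories\<close>

text \<open>
  \<open>Plus\<close> needs no object arguments, because an arrow determines its domain and codomain.
\<close>

record ('o, 'm) addcat = "('o, 'm) cat" +
  Plus :: "'m \<Rightarrow> 'm \<Rightarrow> 'm"  (infixl \<open>\<^bold>+\<index>\<close> 65)
  Zero :: "'o \<Rightarrow> 'o \<Rightarrow> 'm"

locale preadditive_category = category C
  for C :: "('o, 'm, 'r) addcat_scheme" (structure) +
  assumes Hom_group: "X \<in> Ob C \<Longrightarrow> Y \<in> Ob C \<Longrightarrow>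
      comm_group \<lparr>carrier = Hom C X Y, mult = Plus C, one = Zero C X Y\<rparr>"
    and Comp_Plus: "f \<in> Hom C X Y \<Longrightarrow> f' \<in> Hom C X Y \<Longrightarrow> g \<in> Hom C Y Z
      \<Longrightarrow> g \<cdot> (f \<^bold>+ f') = (g \<cdot> f) \<^bold>+ (g \<cdot> f')"
    and Plus_Comp: "f \<in> Hom C X Y \<Longrightarrow> g \<in> Hom C Y Z \<Longrightarrow> g' \<in> Hom C Y Z
      \<Longrightarrow> (g \<^bold>+ g') \<cdot> f = (g \<cdot> f) \<^bold>+ (g' \<cdot> f)"

definition zero_object :: "('o, 'm, 'r) cat_scheme \<Rightarrow> 'o \<Rightarrow> bool" where
  "zero_object C N \<longleftrightarrow> N \<in> Ob C \<and>
    (\<forall>X\<in>Ob C. (\<exists>!f. f \<in> Hom C X N) \<and> (\<exists>!f. f \<in> Hom C N X))"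

definition biproduct ::
  "('o, 'm, 'r) addcat_scheme \<Rightarrow> 'o \<Rightarrow> 'o \<Rightarrow> 'o \<Rightarrow> 'm \<Rightarrow> 'm \<Rightarrow> 'm \<Rightarrow> 'm \<Rightarrow> bool" where
  "biproduct C X Y S i j p q \<longleftrightarrow> S \<in> Ob C \<and>
    i \<in> Hom C X S \<and> j \<in> Hom C Y S \<and> p \<in> Hom C S X \<and> q \<in> Hom C S Y \<and>
    p \<cdot>\<^bsub>C\<^esub> i = Id C X \<and> q \<cdot>\<^bsub>C\<^esub> j = Id C Y \<and>
    q \<cdot>\<^bsub>C\<^esub> i = Zero C X Y \<and> p \<cdot>\<^bsub>C\<^esub> j = Zero C Y X \<and>
    (i \<cdot>\<^bsub>C\<^esub> p) \<^bold>+\<^bsub>C\<^esub> (j \<cdot>\<^bsub>C\<^esub> q) = Id C S"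

locale additive_category = preadditive_category C
  for C :: "('o, 'm, 'r) addcat_scheme" (structure) +
  assumes ex_zero_object: "\<exists>N. zero_object C N"
    and ex_biproduct: "X \<in> Ob C \<Longrightarrow> Y \<in> Ob C \<Longrightarrow> \<exists>S i j p q. biproduct C X Y S i j p q"

definition kernel_of :: "('o, 'm, 'r) addcat_scheme \<Rightarrow> 'm \<Rightarrow> 'm \<Rightarrow> bool" where
  "kernel_of C k f \<longleftrightarrow> f \<in> Arr C \<and> k \<in> Hom C (Dom C k) (Dom C f) \<and>
    f \<cdot>\<^bsub>C\<^esub> k = Zero C (Dom C k) (Cod C f) \<and>
    (\<forall>T\<in>Ob C. \<forall>a\<in>Hom C T (Dom C f). f \<cdot>\<^bsub>C\<^esub> a = Zero C T (Cod C f) \<longrightarrow>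
      (\<exists>!t. t \<in> Hom C T (Dom C k) \<and> k \<cdot>\<^bsub>C\<^esub> t = a))"

definition cokernel_of :: "('o, 'm, 'r) addcat_scheme \<Rightarrow> 'm \<Rightarrow> 'm \<Rightarrow> bool" where
  "cokernel_of C c f \<longleftrightarrow> f \<in> Arr C \<and> c \<in> Hom C (Cod C f) (Cod C c) \<and>
    c \<cdot>\<^bsub>C\<^esub> f = Zero C (Dom C f) (Cod C c) \<and>
    (\<forall>T\<in>Ob C. \<forall>a\<in>Hom C (Cod C f) T. a \<cdot>\<^bsub>C\<^esub> f = Zero C (Dom C f) T \<longrightarrow>
      (\<exists>!t. t \<in> Hom C (Cod C c) T \<and> t \<cdot>\<^bsub>C\<^esub> c = a))"

definition is_kernel :: "('o, 'm, 'r) addcat_scheme \<Rightarrow> 'm \<Rightarrow> bool" where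
  "is_kernel C k \<longleftrightarrow> (\<exists>f. kernel_of C k f)"

definition is_cokernel :: "('o, 'm, 'r) addcat_scheme \<Rightarrow> 'm \<Rightarrow> bool" where
  "is_cokernel C c \<longleftrightarrow> (\<exists>f. cokernel_of C c f)"

locale preabelian_category = additive_category C
  for C :: "('o, 'm, 'r) addcat_scheme" (structure) +
  assumes ex_kernel: "f \<in> Arr C \<Longrightarrow> \<exists>k. kernel_of C k f"
    and ex_cokernel: "f \<in> Arr C \<Longrightarrow> \<exists>c. cokernel_of C c f"


section \<open>Strict morphisms\<close>

definition coimage_of :: "('o, 'm, 'r) addcat_scheme \<Rightarrow> 'm \<Rightarrow> 'm \<Rightarrow> bool" where
  "coimage_of C e f \<longleftrightarrow> (\<exists>k. kernel_of C k f \<and> cokernel_of C e k)"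

definition image_of :: "('o, 'm, 'r) addcat_scheme \<Rightarrow> 'm \<Rightarrow> 'm \<Rightarrow> bool" where
  "image_of C m f \<longleftrightarrow> (\<exists>c. cokernel_of C c f \<and> kernel_of C m c)"

text \<open>
  Kernels and cokernels are determined only up to isomorphism, so the comparison morphism
  from the coimage to the image is treated as a relation. Once the coimage \<open>e\<close> and the image
  \<open>m\<close> are chosen, \<open>u\<close> is unique, as \<open>e\<close> is epi and \<open>m\<close> is mono; other choices change \<open>u\<close> only by
  composition with isomorphisms on both sides, so strictness does not depend on them.
\<close>

definition comparison_of :: "('o, 'm, 'r) addcat_scheme \<Rightarrow> 'm \<Rightarrow> 'm \<Rightarrow> bool" where
  "comparison_of C u f \<longleftrightarrow> (\<exists>e m. coimage_of C e f \<and> image_of C m f \<and>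
    u \<in> Hom C (Cod C e) (Dom C m) \<and> f = m \<cdot>\<^bsub>C\<^esub> (u \<cdot>\<^bsub>C\<^esub> e))"

definition strict_arr :: "('o, 'm, 'r) addcat_scheme \<Rightarrow> 'm \<Rightarrow> bool" where
  "strict_arr C f \<longleftrightarrow> (\<exists>u. comparison_of C u f \<and> iso_arr C u)"


section \<open>Quasi-abelian and integral categories\<close>

locale quasi_abelian_category = preabelian_category C
  for C :: "('o, 'm, 'r) addcat_scheme" (structure) +
  assumes cokernel_pullback:
      "is_cokernel C f \<Longrightarrow> pullback_square C f g f' g' \<Longrightarrow> is_cokernel C f'"
    and kernel_pushout:
      "is_kernel C f \<Longrightarrow> pushout_square C f g f' g' \<Longrightarrow> is_kernel C f'"

locale integral_category = preabelian_category C
  for C :: "('o, 'm, 'r) addcat_scheme" (structure) +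
  assumes epi_pullback:
      "epi_arr C f \<Longrightarrow> pullback_square C f g f' g' \<Longrightarrow> epi_arr C f'"
    and mono_pushout:
      "mono_arr C f \<Longrightarrow> pushout_square C f g f' g' \<Longrightarrow> mono_arr C f'"


section \<open>A type of labels\<close>

text \<open>
  Types cannot be existentially quantified, so an existence statement about categories has to
  fix the types from which objects and arrows are taken. The elements of \<open>label\<close> serve only as
  names: a category can be relabelled along any injection into \<open>label\<close>. The type is large enough
  to name, for instance, all topological vector spaces whose underlying set is a subset of the
  reals, together with the continuous linear maps between them.
\<close>

type_synonym label = "real set set"

end

theory Submission
  imports Defs "HOL-Library.Z2" "HOL-Library.Function_Algebras"
begin

text \<open>
  The category consists of the vector spaces \<open>G\<close> over the field with two elements, equipped
  with two subspaces \<open>L\<close> and \<open>R\<close> such that \<open>L \<inter> R = 0\<close>; morphisms are the linear maps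
  that preserve both subspaces. An arbitrary triple \<open>(G, L, R)\<close> is turned into an object by
  dividing all three spaces by \<open>L \<inter> R\<close>, and this quotient is universal. It is the
  torsion-free quotient for a torsion pair on the representations of the quiver with two
  arrows into a common vertex, whose torsion class is not closed under subobjects. The failure
  of that closure is what prevents the category from being integral.

  Kernels are formed with the induced subspaces. For a map with image \<open>I\<close> in \<open>Y\<close>, the cokernel
  is the quotient of \<open>Y\<close> by the saturation \<open>(L + I) \<inter> (R + I)\<close>. It follows that
  cokernels are the maps that are surjective on all three spaces (\<open>is_cokernel_iff\<close>), and
  kernels the injections with induced subspaces and saturated image (\<open>is_kernel_iff\<close>). The
  former are stable under pullback because the surjectivity can be checked elementwise. For
  the latter, a pushout is a cokernel out of a direct sum (\<open>pushout_is_cokernel\<close>), which gives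
  generators and relations for it, and the conditions on a kernel can be followed through
  these.

  Let \<open>k\<close> be the field. The identity of \<open>k\<close> is a monomorphism from \<open>(k, 0, 0)\<close> to \<open>(k, k, 0)\<close>.
  Its pushout along the map from \<open>(k, 0, 0)\<close> to \<open>(k, 0, k)\<close> would be \<open>(k, k, k)\<close>, so it is
  zero after division by the intersection. Hence the category is not integral
  (\<open>mono_with_zero_pushout\<close>).

  The universal monomorphism is the diagonal inclusion of \<open>(k, 0, 0)\<close> into the plane with its
  two axes. To give a map from the plane to \<open>X\<close> is to give a left and a right vector of \<open>X\<close>,
  so a pushout along a map \<open>1 \<mapsto> x\<close> adjoins a decomposition of \<open>x\<close> as a left plus a
  right vector. Such a decomposition is unique where it exists, since \<open>L \<inter> R = 0\<close>, and
  adjoining one kills no vector of \<open>X\<close> (\<open>universal_mono_diagonal\<close>). But the saturation of the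
  diagonal is the whole plane, so the diagonal inclusion is an epimorphism that is not an
  isomorphism, which excludes strictness (\<open>not_strict_diagonal\<close>).
\<close>

section \<open>Bit sequences and their subspaces\<close>

text \<open>
  Over the field with two elements addition alone determines the linear structure: subspaces
  are subgroups, linear maps are additive maps, and all signs disappear. The space of all
  sequences is infinite-dimensional, which leaves room inside it for direct sums and for
  quotients; all spaces below are subspaces of it.
\<close>

type_synonym vec = "nat \<Rightarrow> bit"

lemma vec_add_self [simp]: "(v :: vec) + v = 0"
proof
  fix n show "(v + v) n = 0 n" by (cases "v n") simp_all
qed

lemma vec_add_self_left [simp]: "(v :: vec) + (v + w) = w"
  by (simp flip: add.assoc)

lemma vec_add_eq_0_iff: "(v :: vec) + w = 0 \<longleftrightarrow> v = w"
  by (metis vec_add_self vec_add_self_left add.right_neutral)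

definition gen :: vec where "gen = (\<lambda>_. 1)"

lemma gen_neq_0 [simp]: "gen \<noteq> 0" "0 \<noteq> gen"
  by (auto simp: gen_def fun_eq_iff)

text \<open>
  A sequence is the same as a pair of sequences, its even and its odd entries, so the direct
  sum of two subspaces is again a subspace of the same space of sequences.
\<close>

definition left_part :: "vec \<Rightarrow> vec" where "left_part w = (\<lambda>n. w (2 * n))"
definition right_part :: "vec \<Rightarrow> vec" where "right_part w = (\<lambda>n. w (2 * n + 1))"
definition in_left :: "vec \<Rightarrow> vec" where "in_left u = (\<lambda>n. if even n then u (n div 2) else 0)"
definition in_right :: "vec \<Rightarrow> vec" where "in_right u = (\<lambda>n. if odd n then u (n div 2) else 0)"

lemma parts_of_embeddings [simp]:
  "left_part (in_left u) = u" "right_part (in_left u) = 0"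
  "left_part (in_right u) = 0" "right_part (in_right u) = u"
  by (auto simp: left_part_def right_part_def in_left_def in_right_def)

lemma in_left_add_in_right [simp]: "in_left (left_part w) + in_right (right_part w) = w"
  by (auto simp: left_part_def right_part_def in_left_def in_right_def fun_eq_iff)

lemma parts_additive [simp]:
  "left_part (u + v) = left_part u + left_part v" "right_part (u + v) = right_part u + right_part v"
  "in_left (u + v) = in_left u + in_left v" "in_right (u + v) = in_right u + in_right v"
  "left_part 0 = 0" "right_part 0 = 0" "in_left 0 = 0" "in_right 0 = 0"
  by (auto simp: left_part_def right_part_def in_left_def in_right_def fun_eq_iff)

definition subsp :: "vec set \<Rightarrow> bool" where
  "subsp S \<longleftrightarrow> 0 \<in> S \<and> (\<forall>u\<in>S. \<forall>v\<in>S. u + v \<in> S)"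

lemma subsp_zero [simp, intro]: "subsp S \<Longrightarrow> 0 \<in> S"
  and subsp_add [intro]: "subsp S \<Longrightarrow> u \<in> S \<Longrightarrow> v \<in> S \<Longrightarrow> u + v \<in> S"
  by (auto simp: subsp_def)

lemma subsp_add_cancel_left: "subsp S \<Longrightarrow> u \<in> S \<Longrightarrow> u + v \<in> S \<longleftrightarrow> v \<in> S"
  by (metis subsp_add vec_add_self_left)

lemma subsp_add_cancel_right: "subsp S \<Longrightarrow> v \<in> S \<Longrightarrow> u + v \<in> S \<longleftrightarrow> u \<in> S"
  by (metis subsp_add_cancel_left add.commute)

text \<open>
  This is how quotients are realised: a subspace has a complement, and the projection onto the
  complement represents the quotient map inside the ambient space.
\<close>

lemma ex_additive_map_with_kernel:
  assumes "subsp D"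
  shows "\<exists>p :: vec \<Rightarrow> vec. (\<forall>u v. p (u + v) = p u + p v) \<and> (\<forall>v. p v = 0 \<longleftrightarrow> v \<in> D)"
proof -
  define s :: "bit \<Rightarrow> vec \<Rightarrow> vec" where "s = (\<lambda>c v n. c * v n)"
  interpret vector_space s
    by unfold_locales (auto simp: s_def fun_eq_iff algebra_simps)
  interpret VP: vector_space_pair s s ..
  have s01: "s c v = (if c = 0 then 0 else v)" for c v
    by (cases c) (auto simp: s_def fun_eq_iff)
  have D: "subspace D"
    using assms by (auto simp: subspace_def s01)
  have "Vector_Spaces.linear s s id" by (simp add: linear_id)
  \<comment> \<open>A linear retraction \<open>g\<close> onto \<open>D\<close>; the identity minus \<open>g\<close> has kernel \<open>D\<close>.\<close>
  from VP.linear_exists_left_inverse_on[OF this D] obtain g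
    where g: "range g \<subseteq> D" "Vector_Spaces.linear s s g" "\<forall>v\<in>D. g v = v" by auto
  have add: "g (u + v) = g u + g v" for u v
    using g(2) by (rule VP.linear_add)
  show ?thesis
  proof (intro exI[of _ "\<lambda>v. v + g v"] conjI allI)
    fix u v
    show "u + v + g (u + v) = u + g u + (v + g v)" by (simp add: add algebra_simps)
    show "v + g v = 0 \<longleftrightarrow> v \<in> D"
      using g by (metis rangeI subsetD vec_add_eq_0_iff)
  qed
qed

text \<open>
Vectors are functions, and so are the maps between them. Equality of maps is to be tested at
vectors, without descending to the entries of their values.
\<close>

declare plus_fun_apply [simp del]

lemmas map_eq_iff = fun_eq_iff[where 'a = vec and 'b = vec]

definition restr :: "vec set \<Rightarrow> (vec \<Rightarrow> vec) \<Rightarrow> vec \<Rightarrow> vec" where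
  "restr S f v = (if v \<in> S then f v else 0)"

lemma restr_in [simp]: "v \<in> S \<Longrightarrow> restr S f v = f v"
  and restr_out [simp]: "v \<notin> S \<Longrightarrow> restr S f v = 0"
  by (simp_all add: restr_def)

section \<open>The category of spaces with two independent subspaces\<close>

text \<open>
  An object is a space with two distinguished subspaces that meet only in zero; no other
  relation between the three spaces is imposed.
\<close>

datatype obj = Obj (tot: "vec set") (lft: "vec set") (rgt: "vec set")

datatype arr = Arrow (src: obj) (tgt: obj) (fn: "vec \<Rightarrow> vec")

definition is_obj :: "obj \<Rightarrow> bool" where
  "is_obj X \<longleftrightarrow> subsp (tot X) \<and> subsp (lft X) \<and> subsp (rgt X) \<and>
     lft X \<subseteq> tot X \<and> rgt X \<subseteq> tot X \<and> lft X \<inter> rgt X \<subseteq> {0}"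

text \<open>
  Maps are normalised to vanish outside their domain, so that equality of morphisms is
  equality of functions and composition is composition of functions.
\<close>

definition is_map :: "obj \<Rightarrow> obj \<Rightarrow> (vec \<Rightarrow> vec) \<Rightarrow> bool" where
  "is_map X Y f \<longleftrightarrow> (\<forall>v\<in>tot X. f v \<in> tot Y) \<and> (\<forall>v\<in>lft X. f v \<in> lft Y) \<and> (\<forall>v\<in>rgt X. f v \<in> rgt Y) \<and>
     (\<forall>u\<in>tot X. \<forall>v\<in>tot X. f (u + v) = f u + f v) \<and> (\<forall>v. v \<notin> tot X \<longrightarrow> f v = 0)"

definition two_subspaces :: "(obj, arr) addcat" where
  "two_subspaces = \<lparr>
     Ob = {X. is_obj X},
     Arr = {a. is_obj (src a) \<and> is_obj (tgt a) \<and> is_map (src a) (tgt a) (fn a)},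
     Dom = src, Cod = tgt,
     Id = (\<lambda>X. Arrow X X (restr (tot X) id)),
     Comp = (\<lambda>b a. Arrow (src a) (tgt b) (fn b \<circ> fn a)),
     Plus = (\<lambda>a b. Arrow (src a) (tgt a) (\<lambda>v. fn a v + fn b v)),
     Zero = (\<lambda>X Y. Arrow X Y (\<lambda>_. 0))\<rparr>"

abbreviation TS where "TS \<equiv> two_subspaces"

lemma is_objD:
  assumes "is_obj X"
  shows "subsp (tot X)" "subsp (lft X)" "subsp (rgt X)" "lft X \<subseteq> tot X" "rgt X \<subseteq> tot X"
    "v \<in> lft X \<Longrightarrow> v \<in> tot X" "v \<in> rgt X \<Longrightarrow> v \<in> tot X"
    "v \<in> lft X \<Longrightarrow> v \<in> rgt X \<Longrightarrow> v = 0"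
  using assms by (auto simp: is_obj_def)

lemma is_objI:
  assumes "subsp (tot X)" "subsp (lft X)" "subsp (rgt X)" "lft X \<subseteq> tot X" "rgt X \<subseteq> tot X"
    "\<And>v. v \<in> lft X \<Longrightarrow> v \<in> rgt X \<Longrightarrow> v = 0"
  shows "is_obj X"
  using assms by (auto simp: is_obj_def)

lemma is_mapD:
  assumes "is_map X Y f"
  shows "v \<in> tot X \<Longrightarrow> f v \<in> tot Y" "v \<in> lft X \<Longrightarrow> f v \<in> lft Y" "v \<in> rgt X \<Longrightarrow> f v \<in> rgt Y"
    "u \<in> tot X \<Longrightarrow> v \<in> tot X \<Longrightarrow> f (u + v) = f u + f v" "v \<notin> tot X \<Longrightarrow> f v = 0"
  using assms by (auto simp: is_map_def)

lemma is_mapI: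
  assumes "\<And>v. v \<in> tot X \<Longrightarrow> f v \<in> tot Y" "\<And>v. v \<in> lft X \<Longrightarrow> f v \<in> lft Y"
    "\<And>v. v \<in> rgt X \<Longrightarrow> f v \<in> rgt Y" "\<And>u v. u \<in> tot X \<Longrightarrow> v \<in> tot X \<Longrightarrow> f (u + v) = f u + f v"
    "\<And>v. v \<notin> tot X \<Longrightarrow> f v = 0"
  shows "is_map X Y f"
  using assms by (auto simp: is_map_def)

lemma is_map_zero_vec: "is_map X Y f \<Longrightarrow> is_obj X \<Longrightarrow> f 0 = 0"
  by (metis is_mapD(4) is_objD(1) subsp_zero vec_add_self)

lemma is_map_id: "is_obj X \<Longrightarrow> is_map X X (restr (tot X) id)"
  by (auto simp: is_map_def is_objD restr_def subsp_add)

lemma is_map_comp: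
  assumes "is_obj X" "is_obj Y" "is_map X Y f" "is_map Y Z g"
  shows "is_map X Z (g \<circ> f)"
  by (rule is_mapI)
    (simp_all add: is_mapD[OF assms(3)] is_mapD[OF assms(4)] is_map_zero_vec[OF assms(4,2)])

lemma is_map_add:
  assumes "is_obj Y" "is_map X Y f" "is_map X Y g"
  shows "is_map X Y (\<lambda>v. f v + g v)"
  by (rule is_mapI)
    (simp_all add: is_mapD[OF assms(2)] is_mapD[OF assms(3)] is_objD[OF assms(1)] subsp_add ac_simps)

lemma is_map_zero: "is_obj Y \<Longrightarrow> is_map X Y (\<lambda>_. 0)"
  by (rule is_mapI) (auto simp: is_objD)

lemma Hom_TS: "a \<in> Hom TS X Y \<longleftrightarrow> (\<exists>f. a = Arrow X Y f \<and> is_obj X \<and> is_obj Y \<and> is_map X Y f)"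
  by (cases a) (auto simp: Hom_def two_subspaces_def)

lemma Arrow_in_Hom_TS [simp]:
  "Arrow X Y f \<in> Hom TS X' Y' \<longleftrightarrow> X' = X \<and> Y' = Y \<and> is_obj X \<and> is_obj Y \<and> is_map X Y f"
  by (auto simp: Hom_TS)

lemma TS_simps [simp]:
  "X \<in> Ob TS \<longleftrightarrow> is_obj X"
  "Arrow X Y f \<in> Arr TS \<longleftrightarrow> is_obj X \<and> is_obj Y \<and> is_map X Y f"
  "Dom TS (Arrow X Y f) = X" "Cod TS (Arrow X Y f) = Y"
  "Id TS X = Arrow X X (restr (tot X) id)"
  "Comp TS (Arrow Y' Z g) (Arrow X Y f) = Arrow X Z (g \<circ> f)"
  "Plus TS (Arrow X Y f) (Arrow X' Y' f') = Arrow X Y (\<lambda>v. f v + f' v)"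
  "Zero TS X Y = Arrow X Y (\<lambda>_. 0)"
  by (auto simp: two_subspaces_def)

lemma all_Hom_TS: "(\<forall>a\<in>Hom TS X Y. P a) \<longleftrightarrow> (is_obj X \<and> is_obj Y \<longrightarrow> (\<forall>f. is_map X Y f \<longrightarrow> P (Arrow X Y f)))"
  by (auto simp: Hom_TS)

lemma ex1_Hom_TS: "(\<exists>!a. a \<in> Hom TS X Y \<and> P a) \<longleftrightarrow> is_obj X \<and> is_obj Y \<and> (\<exists>!f. is_map X Y f \<and> P (Arrow X Y f))"
  unfolding Ex1_def by (auto simp: Hom_TS)

lemma is_map_comp_id: "is_map X Y f \<Longrightarrow> is_obj X \<Longrightarrow> f \<circ> restr (tot X) id = f"
  by (auto simp: map_eq_iff restr_def is_map_zero_vec is_mapD(5)[of X Y f])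

lemma is_map_id_comp: "is_map X Y f \<Longrightarrow> is_obj Y \<Longrightarrow> restr (tot Y) id \<circ> f = f"
  by (auto simp: map_eq_iff restr_def intro: is_mapD(1) dest: is_mapD(1,5))

lemma category_TS: "category TS"
proof
  fix f assume "f \<in> Arr TS"
  then show "Dom TS f \<in> Ob TS" "Cod TS f \<in> Ob TS" by (cases f; simp)+
qed (auto simp: Hom_TS is_map_id is_map_comp is_map_comp_id is_map_id_comp comp_assoc)

lemma comm_group_Hom_TS:
  assumes "is_obj X" "is_obj Y"
  shows "comm_group \<lparr>carrier = Hom TS X Y, mult = Plus TS, one = Zero TS X Y\<rparr>" (is "comm_group ?G")
proof (rule comm_groupI)
  fix a b c
  assume "a \<in> carrier ?G" "b \<in> carrier ?G" "c \<in> carrier ?G"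
  then obtain f g h where abc: "a = Arrow X Y f" "b = Arrow X Y g" "c = Arrow X Y h"
    and maps: "is_map X Y f" "is_map X Y g"
    by (auto simp: Hom_TS)
  show "a \<otimes>\<^bsub>?G\<^esub> b \<in> carrier ?G"
    using is_map_add[OF assms(2) maps] assms abc by simp
  show "a \<otimes>\<^bsub>?G\<^esub> b \<otimes>\<^bsub>?G\<^esub> c = a \<otimes>\<^bsub>?G\<^esub> (b \<otimes>\<^bsub>?G\<^esub> c)"
    "a \<otimes>\<^bsub>?G\<^esub> b = b \<otimes>\<^bsub>?G\<^esub> a" "\<one>\<^bsub>?G\<^esub> \<otimes>\<^bsub>?G\<^esub> a = a"
    using abc by (simp_all add: ac_simps)
next
  fix a
  assume "a \<in> carrier ?G"
  then show "\<exists>b\<in>carrier ?G. b \<otimes>\<^bsub>?G\<^esub> a = \<one>\<^bsub>?G\<^esub>"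
    by (intro bexI[of _ a]) (auto simp: Hom_TS)
qed (use assms in \<open>auto simp: is_map_zero\<close>)

lemma preadditive_TS: "preadditive_category TS"
proof -
  show ?thesis
  proof (intro preadditive_category.intro preadditive_category_axioms.intro category_TS)
    show "comm_group \<lparr>carrier = Hom TS X Y, mult = Plus TS, one = Zero TS X Y\<rparr>"
      if "X \<in> Ob TS" "Y \<in> Ob TS" for X Y
      using that comm_group_Hom_TS by (simp del: TS_simps(8))
    show "g \<cdot>\<^bsub>TS\<^esub> (f \<^bold>+\<^bsub>TS\<^esub> f') = (g \<cdot>\<^bsub>TS\<^esub> f) \<^bold>+\<^bsub>TS\<^esub> (g \<cdot>\<^bsub>TS\<^esub> f')"
      if hom: "f \<in> Hom TS X Y" "f' \<in> Hom TS X Y" "g \<in> Hom TS Y Z" for f f' g X Y Z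
    proof -
      obtain a a' b where "f = Arrow X Y a" "f' = Arrow X Y a'" "g = Arrow Y Z b"
        and *: "is_obj Y" "is_map X Y a" "is_map X Y a'" "is_map Y Z b"
        using hom by (auto simp: Hom_TS)
      moreover have "b (a v + a' v) = b (a v) + b (a' v)" for v
      proof (cases "v \<in> tot X")
        case True
        then show ?thesis using * by (blast intro: is_mapD(1,4))
      next
        case False
        then show ?thesis
          using is_map_zero_vec[OF *(4,1)] by (simp add: is_mapD(5)[OF *(2)] is_mapD(5)[OF *(3)])
      qed
      ultimately show ?thesis by (simp add: map_eq_iff)
    qed
    show "(g \<^bold>+\<^bsub>TS\<^esub> g') \<cdot>\<^bsub>TS\<^esub> f = (g \<cdot>\<^bsub>TS\<^esub> f) \<^bold>+\<^bsub>TS\<^esub> (g' \<cdot>\<^bsub>TS\<^esub> f)"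
      if "f \<in> Hom TS X Y" "g \<in> Hom TS Y Z" "g' \<in> Hom TS Y Z" for f g g' X Y Z
      using that by (auto simp: Hom_TS map_eq_iff)
  qed
qed

definition osum :: "obj \<Rightarrow> obj \<Rightarrow> obj" where
  "osum X Y = Obj {w. left_part w \<in> tot X \<and> right_part w \<in> tot Y}
     {w. left_part w \<in> lft X \<and> right_part w \<in> lft Y} {w. left_part w \<in> rgt X \<and> right_part w \<in> rgt Y}"

lemma in_osum [simp]:
  "w \<in> tot (osum X Y) \<longleftrightarrow> left_part w \<in> tot X \<and> right_part w \<in> tot Y"
  "w \<in> lft (osum X Y) \<longleftrightarrow> left_part w \<in> lft X \<and> right_part w \<in> lft Y"
  "w \<in> rgt (osum X Y) \<longleftrightarrow> left_part w \<in> rgt X \<and> right_part w \<in> rgt Y"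
  by (auto simp: osum_def)

lemma subsp_parts: "subsp A \<Longrightarrow> subsp B \<Longrightarrow> subsp {w. left_part w \<in> A \<and> right_part w \<in> B}"
  by (auto simp: subsp_def)

lemma is_obj_osum:
  assumes "is_obj X" "is_obj Y"
  shows "is_obj (osum X Y)"
proof (rule is_objI)
  fix v assume "v \<in> lft (osum X Y)" "v \<in> rgt (osum X Y)"
  then have "left_part v = 0" "right_part v = 0" using assms by (auto simp: is_objD)
  then show "v = 0" by (metis in_left_add_in_right parts_additive(7,8) add.right_neutral)
qed (use is_objD(1-5)[OF assms(1)] is_objD(1-5)[OF assms(2)] in \<open>auto simp add: osum_def subsp_parts simp del: in_osum\<close>)

lemma biproduct_TS:
  assumes "is_obj X" "is_obj Y"
  shows "\<exists>S i j p q. biproduct TS X Y S i j p q"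
proof -
  let ?S = "osum X Y"
  let ?i = "restr (tot X) in_left" and ?j = "restr (tot Y) in_right"
  let ?p = "restr (tot ?S) left_part" and ?q = "restr (tot ?S) right_part"
  note zero = subsp_zero[OF is_objD(1)] subsp_zero[OF is_objD(2)] subsp_zero[OF is_objD(3)]
  have maps: "is_map X ?S ?i" "is_map Y ?S ?j" "is_map ?S X ?p" "is_map ?S Y ?q"
    unfolding is_map_def restr_def
    using assms by (simp_all add: zero is_objD subsp_add)
  have "?p \<circ> ?i = restr (tot X) id" "?q \<circ> ?j = restr (tot Y) id"
    "?q \<circ> ?i = (\<lambda>_. 0)" "?p \<circ> ?j = (\<lambda>_. 0)"
    "(\<lambda>v. (?i \<circ> ?p) v + (?j \<circ> ?q) v) = restr (tot ?S) id"
    using assms by (simp_all add: map_eq_iff restr_def zero)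
  with assms maps have "biproduct TS X Y ?S (Arrow X ?S ?i) (Arrow Y ?S ?j) (Arrow ?S X ?p) (Arrow ?S Y ?q)"
    by (simp add: biproduct_def is_obj_osum)
  then show ?thesis by blast
qed

definition zobj :: obj where "zobj = Obj {0} {0} {0}"

lemma zobj_simps [simp]: "tot zobj = {0}" "lft zobj = {0}" "rgt zobj = {0}"
  by (auto simp: zobj_def)

lemma is_obj_zobj [simp]: "is_obj zobj" by (auto simp: is_obj_def subsp_def)

lemma is_map_zobj: "is_obj X \<Longrightarrow> is_map X zobj f \<longleftrightarrow> f = (\<lambda>_. 0)" "is_obj X \<Longrightarrow> is_map zobj X f \<longleftrightarrow> f = (\<lambda>_. 0)"
  by (auto simp: is_map_def map_eq_iff is_objD) (metis add.right_neutral vec_add_self)+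

lemma additive_TS: "additive_category TS"
proof -
  interpret preadditive_category TS by (rule preadditive_TS)
  have "zero_object TS zobj"
    by (auto simp: zero_object_def Hom_TS is_map_zobj)
  then show ?thesis
    by unfold_locales (auto simp: biproduct_TS)
qed

section \<open>Kernels and cokernels\<close>

lemma map_image_subsp:
  assumes "subsp S" "\<And>u v. u \<in> S \<Longrightarrow> v \<in> S \<Longrightarrow> f (u + v) = f u + f v"
  shows "subsp (f ` S)"
proof -
  have "f 0 = f 0 + f 0" using assms(2)[of 0 0] subsp_zero[OF assms(1)] by simp
  then have "f 0 = 0" by simp
  then have "0 \<in> f ` S" using subsp_zero[OF assms(1)] by force
  moreover have "f u + f v \<in> f ` S" if "u \<in> S" "v \<in> S" for u v
    using assms(2)[OF that] subsp_add[OF assms(1) that] by (metis imageI)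
  ultimately show ?thesis by (auto simp: subsp_def)
qed

lemma image_tot:
  assumes "is_obj X" "is_map X Y f"
  shows "subsp (f ` tot X)" "f ` tot X \<subseteq> tot Y"
proof -
  show "subsp (f ` tot X)"
    using is_objD(1)[OF assms(1)] is_mapD(4)[OF assms(2)] by (rule map_image_subsp)
  show "f ` tot X \<subseteq> tot Y"
    using is_mapD(1)[OF assms(2)] by (rule image_subsetI)
qed

lemma is_map_eq_iff:
  assumes "is_obj X" "is_map X Y f" "u \<in> tot X" "v \<in> tot X"
  shows "f u = f v \<longleftrightarrow> f (u + v) = 0"
  by (simp add: is_mapD(4)[OF assms(2-4)] vec_add_eq_0_iff)

text \<open>
  Dividing \<open>Y\<close> by \<open>I\<close> makes the two subspaces \<open>(lft Y + I) / I\<close> and \<open>(rgt Y + I) / I\<close> of the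
  quotient, which may meet. Dividing out their intersection as well repairs this, because the
  intersection is contained in both of them. The saturation \<open>(lft Y + I) \<inter> (rgt Y + I)\<close>
  is the kernel of the composite, and so the smallest subspace containing \<open>I\<close> by which \<open>Y\<close> can
  be divided inside the category.
\<close>

definition saturation :: "obj \<Rightarrow> vec set \<Rightarrow> vec set" where
  "saturation Y I = {v. (\<exists>h\<in>lft Y. v + h \<in> I) \<and> (\<exists>n\<in>rgt Y. v + n \<in> I)}"

lemma subsp_saturation:
  assumes "is_obj Y" "subsp I"
  shows "subsp (saturation Y I)"
proof -
  have "\<exists>s\<in>S. u + v + s \<in> I" if "subsp S" "h \<in> S" "h' \<in> S" "u + h \<in> I" "v + h' \<in> I" for S u v h h'
  proof
    show "h + h' \<in> S" using that by auto
    have "u + v + (h + h') = (u + h) + (v + h')" by (simp add: ac_simps)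
    then show "u + v + (h + h') \<in> I" using subsp_add[OF assms(2) that(4,5)] by argo
  qed
  note add = this[OF is_objD(2)[OF assms(1)]] this[OF is_objD(3)[OF assms(1)]]
  show ?thesis
    unfolding subsp_def
  proof (intro conjI ballI)
    show "0 \<in> saturation Y I"
      using subsp_zero[OF assms(2)] is_objD(2,3)[OF assms(1)]
      by (auto simp: saturation_def intro!: bexI[of _ 0])
    show "u + v \<in> saturation Y I" if "u \<in> saturation Y I" "v \<in> saturation Y I" for u v
      using that add unfolding saturation_def by blast
  qed
qed

lemma subset_saturation: "is_obj Y \<Longrightarrow> I \<subseteq> saturation Y I"
  by (auto simp: saturation_def intro!: bexI[of _ 0] dest: is_objD(2,3))

lemma saturation_subset: "is_obj Y \<Longrightarrow> I \<subseteq> tot Y \<Longrightarrow> saturation Y I \<subseteq> tot Y"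
  by (auto simp: saturation_def) (meson in_mono is_objD(1,6) subsp_add_cancel_right)

text \<open>
  A vector of the saturation is congruent modulo \<open>I\<close> to a vector of \<open>lft Y\<close> and to one of
  \<open>rgt Y\<close>. If \<open>I\<close> is sent to zero, its image is therefore in both subspaces of \<open>T\<close>.
\<close>

lemma map_kills_saturation:
  assumes "is_obj Y" "is_obj T" "is_map Y T a" "\<And>i. i \<in> I \<Longrightarrow> a i = 0" "I \<subseteq> tot Y" "v \<in> saturation Y I"
  shows "a v = 0"
proof -
  obtain h n where hn: "h \<in> lft Y" "v + h \<in> I" "n \<in> rgt Y" "v + n \<in> I"
    using assms(6) by (auto simp: saturation_def)
  have "v \<in> tot Y" using assms(6) saturation_subset[OF assms(1,5)] by auto
  then have "a v = a h" "a v = a n"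
    using hn assms(4) by (simp_all add: is_map_eq_iff[OF assms(1,3)] is_objD(6,7)[OF assms(1)])
  then show ?thesis
    using hn is_mapD(2,3)[OF assms(3)] is_objD(8)[OF assms(2)] by metis
qed

text \<open>
  Surjectivity or injectivity on the total space alone does not control the distinguished
  subspaces, and the stronger properties are needed: \<open>strict_onto\<close> characterises the
  cokernels, and \<open>strict_into\<close> the kernels up to a condition on the image.
\<close>

definition strict_onto :: "obj \<Rightarrow> obj \<Rightarrow> (vec \<Rightarrow> vec) \<Rightarrow> bool" where
  "strict_onto Y Q c \<longleftrightarrow> is_map Y Q c \<and> tot Q \<subseteq> c ` tot Y \<and> lft Q \<subseteq> c ` lft Y \<and> rgt Q \<subseteq> c ` rgt Y"

definition strict_into :: "obj \<Rightarrow> obj \<Rightarrow> (vec \<Rightarrow> vec) \<Rightarrow> bool" where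
  "strict_into K X k \<longleftrightarrow> is_map K X k \<and> (\<forall>v\<in>tot K. k v = 0 \<longrightarrow> v = 0) \<and>
     (\<forall>v\<in>tot K. k v \<in> lft X \<longrightarrow> v \<in> lft K) \<and> (\<forall>v\<in>tot K. k v \<in> rgt X \<longrightarrow> v \<in> rgt K)"

lemma quotient_exists:
  assumes Y: "is_obj Y" and I: "subsp I" "I \<subseteq> tot Y"
  shows "\<exists>Q c. is_obj Q \<and> strict_onto Y Q c \<and> (\<forall>v\<in>tot Y. c v = 0 \<longleftrightarrow> v \<in> saturation Y I)"
proof -
  let ?D = "saturation Y I"
  obtain p :: "vec \<Rightarrow> vec" where add: "\<And>u v. p (u + v) = p u + p v" and ker: "\<And>v. p v = 0 \<longleftrightarrow> v \<in> ?D"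
    using ex_additive_map_with_kernel[OF subsp_saturation[OF Y I(1)]] by blast
  let ?Q = "Obj (p ` tot Y) (p ` lft Y) (p ` rgt Y)"
  have "is_obj ?Q"
  proof (rule is_objI)
    fix v assume "v \<in> lft ?Q" "v \<in> rgt ?Q"
    then obtain h n where hn: "h \<in> lft Y" "n \<in> rgt Y" "v = p h" "v = p n" by auto
    then have "h + n \<in> ?D" by (metis add ker vec_add_self)
    then obtain h' where h': "h' \<in> lft Y" "h + n + h' \<in> I" by (auto simp: saturation_def)
    \<comment> \<open>The element \<open>n\<close> lies in \<open>rgt Y\<close> and, modulo \<open>I\<close>, equals \<open>h + h'\<close>, which lies in \<open>lft Y\<close>.\<close>
    have "n + (h + h') \<in> I" using h'(2) by (simp add: ac_simps)
    moreover have "h + h' \<in> lft Y" using is_objD(2)[OF Y] hn h' by auto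
    moreover have "n + n \<in> I" using I by simp
    ultimately have "n \<in> ?D" using hn(2) unfolding saturation_def by blast
    then have "p n = 0" using ker by blast
    then show "v = 0" using hn by simp
  qed (use is_objD(1-5)[OF Y] in \<open>auto intro!: map_image_subsp simp: add\<close>)
  moreover have "strict_onto Y ?Q (restr (tot Y) p)"
    using is_objD[OF Y] unfolding strict_onto_def is_map_def
    by (auto simp: add restr_def image_iff)
  ultimately show ?thesis using ker by (metis restr_in)
qed

text \<open>
  The factorisation exists on underlying spaces as for any surjection; it respects the
  subspaces because every element of \<open>lft Q\<close> or \<open>rgt Q\<close> can be lifted within \<open>lft Y\<close> or
  \<open>rgt Y\<close>.
\<close>

lemma factor_through_strict_onto:
  assumes Y: "is_obj Y" and Q: "is_obj Q" and c: "strict_onto Y Q c" and a: "is_map Y T a"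
    and kills: "\<And>v. v \<in> tot Y \<Longrightarrow> c v = 0 \<Longrightarrow> a v = 0"
  shows "\<exists>!t. is_map Q T t \<and> t \<circ> c = a"
proof -
  have cm: "is_map Y Q c" and onto: "\<And>q. q \<in> tot Q \<Longrightarrow> \<exists>v\<in>tot Y. q = c v"
    "\<And>q. q \<in> lft Q \<Longrightarrow> \<exists>v\<in>lft Y. q = c v" "\<And>q. q \<in> rgt Q \<Longrightarrow> \<exists>v\<in>rgt Y. q = c v"
    using c by (auto simp: strict_onto_def)
  define t where "t = restr (tot Q) (\<lambda>q. a (SOME v. v \<in> tot Y \<and> c v = q))"
  have t: "t (c v) = a v" if v: "v \<in> tot Y" for v
  proof -
    define w where "w = (SOME w. w \<in> tot Y \<and> c w = c v)"
    have w: "w \<in> tot Y" "c w = c v"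
      using someI[of "\<lambda>w. w \<in> tot Y \<and> c w = c v" v] v unfolding w_def by auto
    then have "a w = a v"
      using v kills subsp_add[OF is_objD(1)[OF Y] w(1) v]
      by (simp add: is_map_eq_iff[OF Y cm] is_map_eq_iff[OF Y a])
    then show ?thesis using is_mapD(1)[OF cm v] by (simp add: t_def w_def)
  qed
  have "is_map Q T t"
  proof (rule is_mapI)
    show "t q \<in> tot T" if "q \<in> tot Q" for q
      using onto(1)[OF that] t is_mapD(1)[OF a] by auto
    show "t q \<in> lft T" if "q \<in> lft Q" for q
      using onto(2)[OF that] t is_mapD(2)[OF a] is_objD(6)[OF Y] by auto
    show "t q \<in> rgt T" if "q \<in> rgt Q" for q
      using onto(3)[OF that] t is_mapD(3)[OF a] is_objD(7)[OF Y] by auto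
    show "t (q + r) = t q + t r" if qr: "q \<in> tot Q" "r \<in> tot Q" for q r
    proof -
      obtain v w where "v \<in> tot Y" "w \<in> tot Y" "q = c v" "r = c w" using qr onto(1) by metis
      then show ?thesis
        using t is_mapD(4)[OF a] is_mapD(4)[OF cm] subsp_add[OF is_objD(1)[OF Y]] by metis
    qed
  qed (simp add: t_def)
  moreover have "t \<circ> c = a"
  proof
    fix v show "(t \<circ> c) v = a v"
      using t is_mapD(5)[OF cm] is_mapD(5)[OF a] is_map_zero_vec[OF \<open>is_map Q T t\<close> Q]
      by (cases "v \<in> tot Y") auto
  qed
  moreover have "s = t" if s: "is_map Q T s" "s \<circ> c = a" for s
  proof
    fix q show "s q = t q"
    proof (cases "q \<in> tot Q")
      case True
      then obtain v where "v \<in> tot Y" "q = c v" using onto(1) by blast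
      then show ?thesis using t s(2) by auto
    next
      case False
      then show ?thesis using is_mapD(5)[OF s(1)] by (simp add: t_def)
    qed
  qed
  ultimately show ?thesis by blast
qed

lemma strict_into_inj:
  assumes "is_obj K" "strict_into K X k" "u \<in> tot K" "v \<in> tot K" "k u = k v"
  shows "u = v"
proof -
  have "k (u + v) = 0" using assms is_map_eq_iff[of K X k u v] by (auto simp: strict_into_def)
  then have "u + v = 0" using assms subsp_add[OF is_objD(1)] by (auto simp: strict_into_def)
  then show ?thesis by (simp add: vec_add_eq_0_iff)
qed

lemma factor_through_strict_into:
  assumes K: "is_obj K" and T: "is_obj T" and k: "strict_into K X k" and a: "is_map T X a"
    and sub: "a ` tot T \<subseteq> k ` tot K"
  shows "\<exists>!t. is_map T K t \<and> k \<circ> t = a"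
proof -
  have km: "is_map K X k" and refl: "\<And>v. v \<in> tot K \<Longrightarrow> k v \<in> lft X \<Longrightarrow> v \<in> lft K"
    "\<And>v. v \<in> tot K \<Longrightarrow> k v \<in> rgt X \<Longrightarrow> v \<in> rgt K"
    using k by (auto simp: strict_into_def)
  note inj = strict_into_inj[OF K k]
  define t where "t = restr (tot T) (\<lambda>v. SOME w. w \<in> tot K \<and> k w = a v)"
  have t: "t v \<in> tot K" "k (t v) = a v" if "v \<in> tot T" for v
  proof -
    have "\<exists>w. w \<in> tot K \<and> k w = a v" using sub that by force
    from someI_ex[OF this] show "t v \<in> tot K" "k (t v) = a v" using that by (simp_all add: t_def)
  qed
  have "is_map T K t"
  proof (rule is_mapI)
    show "t v \<in> tot K" if "v \<in> tot T" for v using t(1)[OF that] .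
    show "t v \<in> lft K" if "v \<in> lft T" for v
      using refl(1) t is_objD(6)[OF T that] is_mapD(2)[OF a that] by metis
    show "t v \<in> rgt K" if "v \<in> rgt T" for v
      using refl(2) t is_objD(7)[OF T that] is_mapD(3)[OF a that] by metis
    show "t (u + v) = t u + t v" if uv: "u \<in> tot T" "v \<in> tot T" for u v
    proof (rule inj)
      have "u + v \<in> tot T" using uv is_objD(1)[OF T] by auto
      then show "t (u + v) \<in> tot K" "t u + t v \<in> tot K" "k (t (u + v)) = k (t u + t v)"
        using t uv subsp_add[OF is_objD(1)[OF K]] is_mapD(4)[OF km] is_mapD(4)[OF a] by simp_all
    qed
  qed (simp add: t_def)
  moreover have "k \<circ> t = a"
  proof
    fix v show "(k \<circ> t) v = a v"
      using t is_mapD(5)[OF a] is_map_zero_vec[OF km K] by (cases "v \<in> tot T") (auto simp: t_def)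
  qed
  moreover have "s = t" if s: "is_map T K s" "k \<circ> s = a" for s
  proof
    fix v show "s v = t v"
    proof (cases "v \<in> tot T")
      case True
      have "k (s v) = k (t v)" using s(2) t(2)[OF True] by auto
      then show ?thesis using inj is_mapD(1)[OF s(1) True] t(1)[OF True] by blast
    next
      case False
      then show ?thesis using is_mapD(5)[OF s(1)] by (simp add: t_def)
    qed
  qed
  ultimately show ?thesis by blast
qed

lemma all_Ob_TS: "(\<forall>X\<in>Ob TS. P X) \<longleftrightarrow> (\<forall>X. is_obj X \<longrightarrow> P X)"
  by auto

text \<open>
  The universal properties are stated once more in terms of maps, to be free of the encoding
  of morphisms with their source and target.
\<close>

lemma kernel_of_TS:
  "kernel_of TS (Arrow K X' k) (Arrow X Y f) \<longleftrightarrow> X' = X \<and> is_obj K \<and> is_obj X \<and> is_obj Y \<and>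
     is_map X Y f \<and> is_map K X k \<and> f \<circ> k = (\<lambda>_. 0) \<and>
     (\<forall>T. is_obj T \<longrightarrow> (\<forall>a. is_map T X a \<longrightarrow> f \<circ> a = (\<lambda>_. 0) \<longrightarrow> (\<exists>!t. is_map T K t \<and> k \<circ> t = a)))"
  by (cases "X' = X"; cases "is_obj K"; cases "is_obj X"; cases "is_obj Y")
    (simp_all add: kernel_of_def all_Ob_TS all_Hom_TS ex1_Hom_TS)

lemma cokernel_of_TS:
  "cokernel_of TS (Arrow Y' Q c) (Arrow X Y f) \<longleftrightarrow> Y' = Y \<and> is_obj Q \<and> is_obj X \<and> is_obj Y \<and>
     is_map X Y f \<and> is_map Y Q c \<and> c \<circ> f = (\<lambda>_. 0) \<and>
     (\<forall>T. is_obj T \<longrightarrow> (\<forall>a. is_map Y T a \<longrightarrow> a \<circ> f = (\<lambda>_. 0) \<longrightarrow> (\<exists>!t. is_map Q T t \<and> t \<circ> c = a)))"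
  by (cases "Y' = Y"; cases "is_obj Q"; cases "is_obj X"; cases "is_obj Y")
    (simp_all add: cokernel_of_def all_Ob_TS all_Hom_TS ex1_Hom_TS)

lemma cokernel_if_strict_onto:
  assumes X: "is_obj X" and Y: "is_obj Y" and Q: "is_obj Q" and f: "is_map X Y f" and c: "strict_onto Y Q c"
    and ker: "\<And>v. v \<in> tot Y \<Longrightarrow> c v = 0 \<longleftrightarrow> v \<in> saturation Y (f ` tot X)"
  shows "cokernel_of TS (Arrow Y Q c) (Arrow X Y f)"
proof -
  have cm: "is_map Y Q c" using c by (simp add: strict_onto_def)
  have zero: "c (f v) = 0" for v
  proof (cases "v \<in> tot X")
    case True
    then show ?thesis using ker is_mapD(1)[OF f] subset_saturation[OF Y, of "f ` tot X"] by auto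
  qed (simp add: is_mapD(5)[OF f] is_map_zero_vec[OF cm Y])
  have "\<exists>!t. is_map Q T t \<and> t \<circ> c = a" if T: "is_obj T" and a: "is_map Y T a" and af: "a \<circ> f = (\<lambda>_. 0)" for T a
  proof (rule factor_through_strict_onto[OF Y Q c a])
    fix v assume "v \<in> tot Y" "c v = 0"
    then have "v \<in> saturation Y (f ` tot X)" using ker by simp
    then show "a v = 0"
      by (rule map_kills_saturation[OF Y T a, rotated 2]) (use af image_tot[OF X f] in \<open>auto simp: fun_eq_iff\<close>)
  qed
  with assms cm zero show ?thesis by (auto simp: cokernel_of_TS)
qed

lemma cokernel_exists:
  assumes "is_obj X" "is_obj Y" "is_map X Y f"
  obtains Q c where "is_obj Q" "strict_onto Y Q c" "cokernel_of TS (Arrow Y Q c) (Arrow X Y f)"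
    "\<And>v. v \<in> tot Y \<Longrightarrow> c v = 0 \<longleftrightarrow> v \<in> saturation Y (f ` tot X)"
  using quotient_exists[OF assms(2) image_tot[OF assms(1,3)]] cokernel_if_strict_onto[OF assms(1,2) _ assms(3)]
  by metis

text \<open>
  Any cokernel of \<open>f\<close> is isomorphic to the quotient by the saturation of the image of \<open>f\<close>, and
  the isomorphism carries over surjectivity on each of the three spaces as well as the kernel.
\<close>

theorem cokernel_of_iff:
  "cokernel_of TS (Arrow Y' Q c) (Arrow X Y f) \<longleftrightarrow> Y' = Y \<and> is_obj Q \<and> is_obj X \<and> is_obj Y \<and>
     is_map X Y f \<and> strict_onto Y Q c \<and> (\<forall>v\<in>tot Y. c v = 0 \<longleftrightarrow> v \<in> saturation Y (f ` tot X))"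
  (is "?L \<longleftrightarrow> ?R")
proof
  assume L: ?L
  then have *: "Y' = Y" "is_obj Q" "is_obj X" "is_obj Y" "is_map Y Q c" "is_map X Y f" "c \<circ> f = (\<lambda>_. 0)"
    and up: "\<And>T a. is_obj T \<Longrightarrow> is_map Y T a \<Longrightarrow> a \<circ> f = (\<lambda>_. 0) \<Longrightarrow> \<exists>!t. is_map Q T t \<and> t \<circ> c = a"
    by (auto simp: cokernel_of_TS)
  obtain R d where R: "is_obj R" "strict_onto Y R d" "cokernel_of TS (Arrow Y R d) (Arrow X Y f)"
    and kd: "\<And>v. v \<in> tot Y \<Longrightarrow> d v = 0 \<longleftrightarrow> v \<in> saturation Y (f ` tot X)"
    using cokernel_exists *(3,4,6) by metis
  have d: "is_map Y R d" using R(2) by (simp add: strict_onto_def)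
  obtain t where t: "is_map Q R t" "t \<circ> c = d"
    using up[OF R(1) d] R(3) unfolding cokernel_of_TS by blast
  obtain s where s: "is_map R Q s" "s \<circ> d = c"
    using R(3) *(2,5,7) unfolding cokernel_of_TS by blast
  have "s \<circ> t = restr (tot Q) id"
  proof (rule ex1E[OF up[OF *(2,5,7)]])
    fix r assume "\<forall>r'. is_map Q Q r' \<and> r' \<circ> c = c \<longrightarrow> r' = r"
    moreover have "is_map Q Q (s \<circ> t)" using is_map_comp[OF *(2) R(1) t(1) s(1)] .
    moreover have "s \<circ> t \<circ> c = c" using s t by (simp add: comp_assoc)
    ultimately show ?thesis using is_map_id[OF *(2)] is_map_id_comp[OF *(5,2)] by metis
  qed
  then have st: "s (t q) = q" if "q \<in> tot Q" for q
    using that by (metis comp_apply restr_in id_apply)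
  have sd: "s (d v) = c v" and tc: "t (c v) = d v" for v
    using s(2) t(2) by (metis comp_apply)+
  have onto: "q \<in> c ` S" if "q \<in> tot Q" "t q \<in> d ` S" for q S
    using st[OF that(1)] that(2) sd by (metis imageE imageI)
  have "strict_onto Y Q c"
    unfolding strict_onto_def
  proof (intro conjI subsetI)
    show "q \<in> c ` tot Y" if "q \<in> tot Q" for q
      using onto[OF that] is_mapD(1)[OF t(1) that] R(2) by (auto simp: strict_onto_def)
    show "q \<in> c ` lft Y" if "q \<in> lft Q" for q
      using onto[OF is_objD(6)[OF *(2) that]] is_mapD(2)[OF t(1) that] R(2) by (auto simp: strict_onto_def)
    show "q \<in> c ` rgt Y" if "q \<in> rgt Q" for q
      using onto[OF is_objD(7)[OF *(2) that]] is_mapD(3)[OF t(1) that] R(2) by (auto simp: strict_onto_def)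
  qed (rule *(5))
  moreover have "c v = 0 \<longleftrightarrow> d v = 0" for v
    using sd tc is_map_zero_vec[OF s(1) R(1)] is_map_zero_vec[OF t(1) *(2)] by metis
  ultimately show ?R using * kd by simp
qed (use cokernel_if_strict_onto in auto)

text \<open>
  A subspace with the two induced subspaces is an object again, as the intersection can only
  shrink.
\<close>

lemma strict_subobject:
  assumes X: "is_obj X" and S: "subsp S" "S \<subseteq> tot X"
  shows "is_obj (Obj S (lft X \<inter> S) (rgt X \<inter> S))" "strict_into (Obj S (lft X \<inter> S) (rgt X \<inter> S)) X (restr S id)"
proof -
  have "subsp (A \<inter> S)" if "subsp A" for A
    using that S(1) by (auto simp: subsp_def)
  then show "is_obj (Obj S (lft X \<inter> S) (rgt X \<inter> S))"
    using is_objD(1-3)[OF X] is_objD(8)[OF X] S by (intro is_objI) auto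
  show "strict_into (Obj S (lft X \<inter> S) (rgt X \<inter> S)) X (restr S id)"
    using S subsp_add[OF S(1)] by (auto simp: strict_into_def is_map_def)
qed

lemma kernel_space:
  assumes "is_obj X" "is_map X Y f"
  shows "subsp {v\<in>tot X. f v = 0}"
proof -
  have "u + v \<in> tot X \<and> f (u + v) = 0" if "u \<in> tot X" "v \<in> tot X" "f u = 0" "f v = 0" for u v
    using subsp_add[OF is_objD(1)[OF assms(1)] that(1,2)] is_mapD(4)[OF assms(2) that(1,2)] that(3,4) by simp
  then show ?thesis
    using is_map_zero_vec[OF assms(2,1)] subsp_zero[OF is_objD(1)[OF assms(1)]] unfolding subsp_def by blast
qed

lemma strict_kernel_exists:
  assumes "is_obj X" "is_map X Y f"
  obtains K k where "is_obj K" "strict_into K X k" "k ` tot K = {v\<in>tot X. f v = 0}"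
proof -
  let ?S = "{v\<in>tot X. f v = 0}"
  have "restr ?S id ` ?S = ?S" by (auto simp: image_def)
  then show ?thesis
    using that strict_subobject[OF assms(1) kernel_space[OF assms]] by (metis (no_types, lifting) mem_Collect_eq obj.sel(1) subsetI)
qed

lemma kernel_if_strict_into:
  assumes K: "is_obj K" and X: "is_obj X" and Y: "is_obj Y" and f: "is_map X Y f" and k: "strict_into K X k"
    and im: "k ` tot K = {v\<in>tot X. f v = 0}"
  shows "kernel_of TS (Arrow K X k) (Arrow X Y f)"
proof -
  have km: "is_map K X k" using k by (simp add: strict_into_def)
  have zero: "f (k v) = 0" for v
    using im is_mapD(5)[OF km] is_map_zero_vec[OF f X] by (cases "v \<in> tot K") auto
  have "\<exists>!t. is_map T K t \<and> k \<circ> t = a" if "is_obj T" "is_map T X a" "f \<circ> a = (\<lambda>_. 0)" for T a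
    by (rule factor_through_strict_into[OF K that(1) k that(2)])
      (use that(3) is_mapD(1)[OF that(2)] in \<open>auto simp: im fun_eq_iff\<close>)
  with assms km zero show ?thesis by (auto simp: kernel_of_TS)
qed

text \<open>
  As for cokernels, an arbitrary kernel is compared with the concrete one, the space of zeros
  of \<open>f\<close> with its induced subspaces.
\<close>

theorem kernel_of_iff:
  "kernel_of TS (Arrow K X' k) (Arrow X Y f) \<longleftrightarrow> X' = X \<and> is_obj K \<and> is_obj X \<and> is_obj Y \<and>
     is_map X Y f \<and> strict_into K X k \<and> k ` tot K = {v\<in>tot X. f v = 0}"
  (is "?L \<longleftrightarrow> ?R")
proof
  assume L: ?L
  then have *: "X' = X" "is_obj K" "is_obj X" "is_obj Y" "is_map K X k" "is_map X Y f" "f \<circ> k = (\<lambda>_. 0)"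
    and up: "\<And>T a. is_obj T \<Longrightarrow> is_map T X a \<Longrightarrow> f \<circ> a = (\<lambda>_. 0) \<Longrightarrow> \<exists>!t. is_map T K t \<and> k \<circ> t = a"
    by (auto simp: kernel_of_TS)
  obtain L l where L: "is_obj L" "strict_into L X l" "l ` tot L = {v\<in>tot X. f v = 0}"
    using strict_kernel_exists[OF *(3,6)] by metis
  have l: "is_map L X l" using L(2) by (simp add: strict_into_def)
  have kl: "kernel_of TS (Arrow L X l) (Arrow X Y f)"
    using kernel_if_strict_into[OF L(1) *(3,4,6) L(2,3)] .
  obtain t where t: "is_map L K t" "k \<circ> t = l"
    using up[OF L(1) l] kl unfolding kernel_of_TS by blast
  obtain s where s: "is_map K L s" "l \<circ> s = k"
    using kl *(2,5,7) unfolding kernel_of_TS by blast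
  have "t \<circ> s = restr (tot K) id"
  proof (rule ex1E[OF up[OF *(2,5,7)]])
    fix r assume "\<forall>r'. is_map K K r' \<and> k \<circ> r' = k \<longrightarrow> r' = r"
    moreover have "is_map K K (t \<circ> s)" using is_map_comp[OF *(2) L(1) s(1) t(1)] .
    moreover have "k \<circ> (t \<circ> s) = k" using s t by (simp flip: comp_assoc)
    ultimately show ?thesis using is_map_id[OF *(2)] is_map_comp_id[OF *(5,2)] by metis
  qed
  then have ts: "t (s v) = v" if "v \<in> tot K" for v
    using that by (metis comp_apply restr_in id_apply)
  have ls: "l (s v) = k v" and kt: "k (t v) = l v" for v
    using s(2) t(2) by (metis comp_apply)+
  have l_refl: "\<And>w. w \<in> tot L \<Longrightarrow> l w = 0 \<Longrightarrow> w = 0"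
    "\<And>w. w \<in> tot L \<Longrightarrow> l w \<in> lft X \<Longrightarrow> w \<in> lft L" "\<And>w. w \<in> tot L \<Longrightarrow> l w \<in> rgt X \<Longrightarrow> w \<in> rgt L"
    using L(2) by (auto simp: strict_into_def)
  have "strict_into K X k"
    unfolding strict_into_def
  proof (intro conjI ballI impI)
    fix v assume v: "v \<in> tot K"
    note sv = is_mapD(1)[OF s(1) v]
    show "v = 0" if "k v = 0"
      using l_refl(1)[OF sv] ts[OF v] is_map_zero_vec[OF t(1) L(1)] that by (simp add: ls)
    show "v \<in> lft K" if "k v \<in> lft X"
      using is_mapD(2)[OF t(1) l_refl(2)[OF sv]] ts[OF v] that by (simp add: ls)
    show "v \<in> rgt K" if "k v \<in> rgt X"
      using is_mapD(3)[OF t(1) l_refl(3)[OF sv]] ts[OF v] that by (simp add: ls)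
  qed (rule *(5))
  moreover have "k ` tot K = l ` tot L"
  proof (intro subset_antisym image_subsetI)
    show "k v \<in> l ` tot L" if "v \<in> tot K" for v
      using is_mapD(1)[OF s(1) that] by (simp flip: ls)
    show "l v \<in> k ` tot K" if "v \<in> tot L" for v
      using is_mapD(1)[OF t(1) that] by (simp flip: kt)
  qed
  ultimately show ?R using *(1-4,6) L(3) by simp
qed (use kernel_if_strict_into in auto)

lemma preabelian_TS: "preabelian_category TS"
proof -
  interpret additive_category TS by (rule additive_TS)
  show ?thesis
  proof
    fix a assume "a \<in> Arr TS"
    then obtain X Y f where a: "a = Arrow X Y f" "is_obj X" "is_obj Y" "is_map X Y f" by (cases a) auto
    show "\<exists>k. kernel_of TS k a"
      using strict_kernel_exists[OF a(2,4)] kernel_if_strict_into[OF _ a(2,3,4)] a(1) by metis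
    show "\<exists>c. cokernel_of TS c a"
      using cokernel_exists[OF a(2-4)] a(1) by metis
  qed
qed

text \<open>
  Kernels are saturated, by \<open>map_kills_saturation\<close> applied to the map itself.
\<close>

lemma saturation_kernel:
  assumes "is_obj X" "is_obj Y" "is_map X Y f"
  shows "saturation X {v\<in>tot X. f v = 0} = {v\<in>tot X. f v = 0}"
proof -
  let ?K = "{v\<in>tot X. f v = 0}"
  have sub: "?K \<subseteq> tot X" by (rule Collect_restrict)
  have "f v = 0" if "v \<in> saturation X ?K" for v
    using map_kills_saturation[OF assms _ sub that] by simp
  then show ?thesis
    using saturation_subset[OF assms(1) sub] subset_saturation[OF assms(1), of ?K] by blast
qed

text \<open>
  A strict surjection is the cokernel of its own kernel, since the kernel is saturated.
\<close>

theorem is_cokernel_iff: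
  "is_cokernel TS (Arrow Y Q c) \<longleftrightarrow> is_obj Y \<and> is_obj Q \<and> strict_onto Y Q c"
proof
  assume "is_cokernel TS (Arrow Y Q c)"
  then obtain a where a: "cokernel_of TS (Arrow Y Q c) a" by (auto simp: is_cokernel_def)
  show "is_obj Y \<and> is_obj Q \<and> strict_onto Y Q c"
  proof (cases a)
    case (Arrow X Y' f)
    then show ?thesis using a cokernel_of_iff by simp
  qed
next
  assume *: "is_obj Y \<and> is_obj Q \<and> strict_onto Y Q c"
  then have c: "is_map Y Q c" by (simp add: strict_onto_def)
  obtain K k where "is_obj K" "strict_into K Y k" and k: "k ` tot K = {v\<in>tot Y. c v = 0}"
    by (rule strict_kernel_exists[OF _ c]) (use * in auto)
  moreover have "saturation Y {v\<in>tot Y. c v = 0} = {v\<in>tot Y. c v = 0}"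
    using * saturation_kernel[OF _ _ c] by blast
  ultimately have "cokernel_of TS (Arrow Y Q c) (Arrow K Y k)"
    using * by (simp add: cokernel_of_iff strict_into_def)
  then show "is_cokernel TS (Arrow Y Q c)" by (auto simp: is_cokernel_def)
qed

text \<open>
  The kernel of the cokernel of \<open>k\<close> is the saturation of the image of \<open>k\<close>, so \<open>k\<close> can be a
  kernel only if this image is saturated. A monomorphism with induced subspaces may well fail
  this.
\<close>

theorem is_kernel_iff:
  "is_kernel TS (Arrow K X k) \<longleftrightarrow>
     is_obj K \<and> is_obj X \<and> strict_into K X k \<and> saturation X (k ` tot K) \<subseteq> k ` tot K"
proof
  assume "is_kernel TS (Arrow K X k)"
  then obtain a where a: "kernel_of TS (Arrow K X k) a" by (auto simp: is_kernel_def)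
  show "is_obj K \<and> is_obj X \<and> strict_into K X k \<and> saturation X (k ` tot K) \<subseteq> k ` tot K"
  proof (cases a)
    case (Arrow X' Y f)
    then show ?thesis
      using a saturation_kernel[of X Y f] by (simp add: kernel_of_iff)
  qed
next
  assume *: "is_obj K \<and> is_obj X \<and> strict_into K X k \<and> saturation X (k ` tot K) \<subseteq> k ` tot K"
  then have k: "is_map K X k" by (simp add: strict_into_def)
  obtain Q c where c: "is_obj Q" "strict_onto X Q c"
    "\<And>v. v \<in> tot X \<Longrightarrow> c v = 0 \<longleftrightarrow> v \<in> saturation X (k ` tot K)"
    using cokernel_exists[OF _ _ k] * by metis
  have "k ` tot K = {v\<in>tot X. c v = 0}"
    using c(3) * subset_saturation[of X "k ` tot K"] image_tot(2)[OF _ k] by blast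
  with * c have "kernel_of TS (Arrow K X k) (Arrow X Q c)"
    unfolding kernel_of_iff by (simp add: strict_onto_def)
  then show "is_kernel TS (Arrow K X k)" by (auto simp: is_kernel_def)
qed

section \<open>Pullbacks and pushouts\<close>

text \<open>
  Vectors of \<open>X\<close>, of \<open>lft X\<close> and of \<open>rgt X\<close> correspond to the maps into \<open>X\<close> from a line with
  no distinguished subspace, with itself as the left one, and with itself as the right one.
  With these test objects, categorical properties can be read off elementwise.
\<close>

definition line :: "bool \<Rightarrow> bool \<Rightarrow> obj" where
  "line l r = Obj {0, gen} (if l then {0, gen} else {0}) (if r then {0, gen} else {0})"

definition point :: "vec \<Rightarrow> vec \<Rightarrow> vec" where
  "point x v = (if v = gen then x else 0)"

lemma line_simps [simp]:
  "tot (line l r) = {0, gen}" "lft (line l r) = (if l then {0, gen} else {0})"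
  "rgt (line l r) = (if r then {0, gen} else {0})"
  by (auto simp: line_def)

lemma point_simps [simp]: "point x gen = x" "point x 0 = 0"
  by (auto simp: point_def)

lemma is_obj_line: "is_obj (line l r) \<longleftrightarrow> \<not> (l \<and> r)"
  by (auto simp: is_obj_def subsp_def)

lemma is_map_point:
  assumes "is_obj X" "x \<in> tot X" "l \<Longrightarrow> x \<in> lft X" "r \<Longrightarrow> x \<in> rgt X"
  shows "is_map (line l r) X (point x)"
  using assms is_objD(1-3)[OF assms(1)] by (auto simp: is_map_def point_def)

lemma mono_TS_iff:
  "mono_arr TS (Arrow X Y f) \<longleftrightarrow> is_obj X \<and> is_obj Y \<and> is_map X Y f \<and> (\<forall>v\<in>tot X. f v = 0 \<longrightarrow> v = 0)"
  (is "?L \<longleftrightarrow> ?R")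
proof
  assume L: ?L
  then have *: "is_obj X" "is_obj Y" "is_map X Y f"
    and mono: "\<And>T u v. is_obj T \<Longrightarrow> is_map T X u \<Longrightarrow> is_map T X v \<Longrightarrow> f \<circ> u = f \<circ> v \<Longrightarrow> u = v"
    by (auto simp: mono_arr_def all_Hom_TS)
  have "v = 0" if "v \<in> tot X" "f v = 0" for v
  proof -
    have "f (point v w) = f 0" for w
      using that is_map_zero_vec[OF *(3,1)] by (simp add: point_def)
    then have "f \<circ> point v = f \<circ> (\<lambda>_. 0)" by (simp add: map_eq_iff)
    then have "point v = (\<lambda>_. 0)"
      using mono[of "line False False"] is_map_point[OF *(1) that(1)] is_map_zero[OF *(1)]
      by (simp add: is_obj_line)
    then show ?thesis by (metis point_simps(1))
  qed
  with * show ?R by blast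
next
  assume R: ?R
  have "u = v" if uv: "is_map T X u" "is_map T X v" "f \<circ> u = f \<circ> v" for T u v
  proof
    fix w show "u w = v w"
    proof (cases "w \<in> tot T")
      case True
      have w: "u w \<in> tot X" "v w \<in> tot X" using is_mapD(1)[OF uv(1) True] is_mapD(1)[OF uv(2) True] .
      have "f (u w) = f (v w)" using uv(3) by (metis comp_apply)
      then have "f (u w + v w) = 0" using is_map_eq_iff[of X Y f] R w by blast
      then have "u w + v w = 0" using R w subsp_add[OF is_objD(1)] by blast
      then show ?thesis by (simp add: vec_add_eq_0_iff)
    next
      case False
      then show ?thesis by (simp add: is_mapD(5)[OF uv(1)] is_mapD(5)[OF uv(2)])
    qed
  qed
  with R show ?L by (simp add: mono_arr_def all_Hom_TS)
qed

lemma pullback_TS: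
  "pullback_square TS (Arrow A B f) (Arrow X B' g) (Arrow P X' f') (Arrow P' A' g') \<longleftrightarrow>
     B' = B \<and> X' = X \<and> P' = P \<and> A' = A \<and> is_obj A \<and> is_obj B \<and> is_obj X \<and> is_obj P \<and>
     is_map A B f \<and> is_map X B g \<and> is_map P X f' \<and> is_map P A g' \<and> f \<circ> g' = g \<circ> f' \<and>
     (\<forall>T. is_obj T \<longrightarrow> (\<forall>a. is_map T A a \<longrightarrow> (\<forall>b. is_map T X b \<longrightarrow> f \<circ> a = g \<circ> b \<longrightarrow>
       (\<exists>!t. is_map T P t \<and> g' \<circ> t = a \<and> f' \<circ> t = b))))"
  by (cases "is_obj A"; cases "is_obj B"; cases "is_obj X"; cases "is_obj P";
      cases "B' = B"; cases "X' = X"; cases "P' = P"; cases "A' = A")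
    (simp_all add: pullback_square_def all_Ob_TS all_Hom_TS ex1_Hom_TS cong: conj_cong)

lemma pushout_TS:
  "pushout_square TS (Arrow A B f) (Arrow A' X g) (Arrow X' P f') (Arrow B' P' g') \<longleftrightarrow>
     A' = A \<and> X' = X \<and> P' = P \<and> B' = B \<and> is_obj A \<and> is_obj B \<and> is_obj X \<and> is_obj P \<and>
     is_map A B f \<and> is_map A X g \<and> is_map X P f' \<and> is_map B P g' \<and> g' \<circ> f = f' \<circ> g \<and>
     (\<forall>T. is_obj T \<longrightarrow> (\<forall>a. is_map B T a \<longrightarrow> (\<forall>b. is_map X T b \<longrightarrow> a \<circ> f = b \<circ> g \<longrightarrow>
       (\<exists>!t. is_map P T t \<and> t \<circ> g' = a \<and> t \<circ> f' = b))))"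
  by (cases "is_obj A"; cases "is_obj B"; cases "is_obj X"; cases "is_obj P";
      cases "A' = A"; cases "X' = X"; cases "P' = P"; cases "B' = B")
    (simp_all add: pushout_square_def all_Ob_TS all_Hom_TS ex1_Hom_TS cong: conj_cong)

text \<open>
  The compatible pair \<open>(a, x)\<close> is a pair of maps from a line, and its lift to the pullback is
  the value of the induced map at the generator. The flags \<open>l\<close> and \<open>r\<close> choose the line
  according to the subspace in which the pair lies.
\<close>

lemma pullback_lift_element:
  assumes sq: "pullback_square TS (Arrow A B f) (Arrow X B g) (Arrow P X f') (Arrow P A g')"
    and ax: "a \<in> tot A" "x \<in> tot X" "f a = g x"
    and lr: "\<not> (l \<and> r)" "l \<Longrightarrow> a \<in> lft A \<and> x \<in> lft X" "r \<Longrightarrow> a \<in> rgt A \<and> x \<in> rgt X"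
  shows "\<exists>p\<in>tot P. f' p = x \<and> (l \<longrightarrow> p \<in> lft P) \<and> (r \<longrightarrow> p \<in> rgt P)"
proof -
  from sq have *: "is_obj A" "is_obj B" "is_obj X" "is_map A B f" "is_map X B g"
    and up: "\<And>T a b. is_obj T \<Longrightarrow> is_map T A a \<Longrightarrow> is_map T X b \<Longrightarrow> f \<circ> a = g \<circ> b \<Longrightarrow>
      \<exists>!t. is_map T P t \<and> g' \<circ> t = a \<and> f' \<circ> t = b"
    by (auto simp: pullback_TS)
  have "f (point a w) = g (point x w)" for w
    using ax(3) is_map_zero_vec[OF *(4,1)] is_map_zero_vec[OF *(5,3)] by (simp add: point_def)
  then have "f \<circ> point a = g \<circ> point x" by (simp add: map_eq_iff)
  then obtain t where t: "is_map (line l r) P t" "f' \<circ> t = point x"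
    using up[of "line l r" "point a" "point x"] is_map_point[of A a l r] is_map_point[of X x l r] * ax lr
    by (auto simp: is_obj_line)
  then have "f' (t gen) = x" by (metis comp_apply point_simps(1))
  moreover have "t gen \<in> tot P" "l \<longrightarrow> t gen \<in> lft P" "r \<longrightarrow> t gen \<in> rgt P"
    using is_mapD(1-3)[OF t(1), of gen] by auto
  ultimately show ?thesis by blast
qed

text \<open>
  Each of the three surjectivity conditions for \<open>f'\<close> at \<open>x\<close> follows by lifting \<open>g x\<close> along \<open>f\<close>
  within the corresponding subspace.
\<close>

lemma cokernel_pullback_TS:
  assumes "is_cokernel TS a" "pullback_square TS a b a' b'"
  shows "is_cokernel TS a'"
proof -
  obtain A B f X B' g P X' f' P' A' g'
    where arr: "a = Arrow A B f" "b = Arrow X B' g" "a' = Arrow P X' f'" "b' = Arrow P' A' g'"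
    by (metis arr.exhaust)
  have eqs: "B' = B" "X' = X" "P' = P" "A' = A"
    using assms(2) unfolding arr pullback_TS by auto
  note sq = assms(2)[unfolded arr eqs]
  note lift = pullback_lift_element[OF sq]
  have *: "is_obj X" "is_obj P" "is_map X B g" "is_map P X f'" "is_obj A"
    using sq by (auto simp: pullback_TS)
  have f: "\<And>y. y \<in> tot B \<Longrightarrow> \<exists>v\<in>tot A. f v = y" "\<And>y. y \<in> lft B \<Longrightarrow> \<exists>v\<in>lft A. f v = y"
    "\<And>y. y \<in> rgt B \<Longrightarrow> \<exists>v\<in>rgt A. f v = y"
    using assms(1) unfolding arr is_cokernel_iff strict_onto_def by blast+
  have "strict_onto P X f'"
    unfolding strict_onto_def
  proof (intro conjI subsetI *(4))
    show "x \<in> f' ` tot P" if x: "x \<in> tot X" for x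
    proof -
      obtain v where "v \<in> tot A" "f v = g x" using f(1) is_mapD(1)[OF *(3) x] by blast
      then show ?thesis using lift[of v x False False] x by auto
    qed
    show "x \<in> f' ` lft P" if x: "x \<in> lft X" for x
    proof -
      obtain v where v: "v \<in> lft A" "f v = g x" using f(2) is_mapD(2)[OF *(3) x] by blast
      then show ?thesis
        using lift[of v x True False] x is_objD(6)[OF *(5) v(1)] is_objD(6)[OF *(1) x] by auto
    qed
    show "x \<in> f' ` rgt P" if x: "x \<in> rgt X" for x
    proof -
      obtain v where v: "v \<in> rgt A" "f v = g x" using f(3) is_mapD(3)[OF *(3) x] by blast
      then show ?thesis
        using lift[of v x False True] x is_objD(7)[OF *(5) v(1)] is_objD(7)[OF *(1) x] by auto
    qed
  qed
  with * show ?thesis by (simp add: arr eqs is_cokernel_iff)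
qed

lemma osum_map_in:
  assumes "is_obj A" "is_map A B f" "is_map A X g"
  shows "is_map A (osum B X) (\<lambda>a. in_left (f a) + in_right (g a))"
  by (rule is_mapI)
    (simp_all add: is_mapD[OF assms(2)] is_mapD[OF assms(3)] ac_simps)

lemma osum_map_out:
  assumes "is_obj B" "is_obj X" "is_obj P" "is_map B P f" "is_map X P g"
  shows "is_map (osum B X) P (restr (tot (osum B X)) (\<lambda>w. f (left_part w) + g (right_part w)))"
proof (rule is_mapI)
  show "restr (tot (osum B X)) (\<lambda>w. f (left_part w) + g (right_part w)) (u + v) =
    restr (tot (osum B X)) (\<lambda>w. f (left_part w) + g (right_part w)) u +
    restr (tot (osum B X)) (\<lambda>w. f (left_part w) + g (right_part w)) v"
    if "u \<in> tot (osum B X)" "v \<in> tot (osum B X)" for u v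
    using that subsp_add[OF is_objD(1)[OF assms(1)]] subsp_add[OF is_objD(1)[OF assms(2)]]
    by (simp add: is_mapD(4)[OF assms(4)] is_mapD(4)[OF assms(5)] ac_simps)
qed (use is_objD(6,7)[OF assms(1)] is_objD(6,7)[OF assms(2)] in
  \<open>simp_all add: is_mapD(1-3)[OF assms(4)] is_mapD(1-3)[OF assms(5)] subsp_add is_objD(1-3)[OF assms(3)]\<close>)

text \<open>
  The usual fact from additive categories that a pushout of \<open>f\<close> and \<open>g\<close> is a cokernel of
  \<open>(f, -g)\<close>; the sign is void here. Together with \<open>cokernel_of_iff\<close> it describes the elements
  of every pushout.
\<close>

theorem pushout_is_cokernel:
  assumes sq: "pushout_square TS (Arrow A B f) (Arrow A X g) (Arrow X P f') (Arrow B P g')"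
  defines "m \<equiv> \<lambda>a. in_left (f a) + in_right (g a)"
    and "s \<equiv> restr (tot (osum B X)) (\<lambda>w. g' (left_part w) + f' (right_part w))"
  shows "cokernel_of TS (Arrow (osum B X) P s) (Arrow A (osum B X) m)"
proof -
  from sq have *: "is_obj A" "is_obj B" "is_obj X" "is_obj P"
    "is_map A B f" "is_map A X g" "is_map X P f'" "is_map B P g'" and comm: "g' \<circ> f = f' \<circ> g"
    and up: "\<And>T a b. is_obj T \<Longrightarrow> is_map B T a \<Longrightarrow> is_map X T b \<Longrightarrow> a \<circ> f = b \<circ> g \<Longrightarrow>
      \<exists>!t. is_map P T t \<and> t \<circ> g' = a \<and> t \<circ> f' = b"
    by (auto simp: pushout_TS)
  let ?S = "osum B X"
  let ?i = "restr (tot B) in_left" and ?j = "restr (tot X) in_right"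
  have S: "is_obj ?S" using is_obj_osum * by blast
  have m: "is_map A ?S m" unfolding m_def using osum_map_in[OF *(1,5,6)] .
  have s: "is_map ?S P s" unfolding s_def using osum_map_out[OF *(2,3,4,8,7)] .
  have i: "is_map B ?S ?i" and j: "is_map X ?S ?j"
    using *(2,3) by (auto simp: is_map_def restr_def is_objD(1-5) subsp_add dest: is_objD(4,5))
  have comm': "g' (f v) = f' (g v)" for v using comm by (metis comp_apply)
  have sm: "s (m v) = 0" for v
    using is_mapD(1)[OF *(5)] is_mapD(1)[OF *(6)] is_map_zero_vec[OF s S]
    by (cases "v \<in> tot A") (auto simp: s_def m_def comm' is_mapD(5)[OF *(5)] is_mapD(5)[OF *(6)])
  have "\<exists>!t. is_map P T t \<and> t \<circ> s = a" if T: "is_obj T" and a: "is_map ?S T a" and am: "a \<circ> m = (\<lambda>_. 0)" for T a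
  proof -
    have ai: "is_map B T (a \<circ> ?i)" and aj: "is_map X T (a \<circ> ?j)"
      using is_map_comp[OF *(2) S i a] is_map_comp[OF *(3) S j a] by auto
    have tot_in: "in_left b \<in> tot ?S" "in_right x \<in> tot ?S" if "b \<in> tot B" "x \<in> tot X" for b x
      using that *(2,3) by (simp_all add: is_objD(1))
    have "a (?i (f v)) = a (?j (g v))" for v
    proof (cases "v \<in> tot A")
      case True
      note fg = is_mapD(1)[OF *(5) True] is_mapD(1)[OF *(6) True]
      have "a (in_left (f v) + in_right (g v)) = 0" using am unfolding m_def by (metis comp_apply)
      then show ?thesis using fg is_map_eq_iff[OF S a tot_in[OF fg]] by simp
    next
      case False
      then show ?thesis
        using is_mapD(5)[OF *(5) False] is_mapD(5)[OF *(6) False] by (simp add: restr_def)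
    qed
    then have eq: "(a \<circ> ?i) \<circ> f = (a \<circ> ?j) \<circ> g" by (simp add: map_eq_iff)
    \<comment> \<open>Maps out of the direct sum are pairs of maps, so both universal properties ask for the same \<open>t\<close>.\<close>
    have "t \<circ> s = a \<longleftrightarrow> t \<circ> g' = a \<circ> ?i \<and> t \<circ> f' = a \<circ> ?j" if t: "is_map P T t" for t
    proof
      have t0: "t 0 = 0" and a0: "a 0 = 0" and f0: "f' 0 = 0" and g0: "g' 0 = 0"
        using is_map_zero_vec t a * S by blast+
      have si: "s (in_left b) = g' b" if "b \<in> tot B" for b
        using that *(3) by (simp add: s_def f0 is_objD(1))
      have sj: "s (in_right x) = f' x" if "x \<in> tot X" for x
        using that *(2) by (simp add: s_def g0 is_objD(1))
      {
        assume ts: "t \<circ> s = a"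
        have "t (g' b) = a (?i b)" for b
          using ts by (cases "b \<in> tot B") (auto simp: si[symmetric] is_mapD(5)[OF *(8)] t0 a0)
        moreover have "t (f' x) = a (?j x)" for x
          using ts by (cases "x \<in> tot X") (auto simp: sj[symmetric] is_mapD(5)[OF *(7)] t0 a0)
        ultimately show "t \<circ> g' = a \<circ> ?i \<and> t \<circ> f' = a \<circ> ?j" by (simp add: map_eq_iff)
      }
      assume "t \<circ> g' = a \<circ> ?i \<and> t \<circ> f' = a \<circ> ?j"
      then have tg: "t (g' b) = a (?i b)" and tf: "t (f' x) = a (?j x)" for b x by (metis comp_apply)+
      have "t (s w) = a w" for w
      proof (cases "w \<in> tot ?S")
        case True
        then have w: "left_part w \<in> tot B" "right_part w \<in> tot X" by auto
        have "t (s w) = t (g' (left_part w)) + t (f' (right_part w))"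
          using True w is_mapD(1)[OF *(7)] is_mapD(1)[OF *(8)]
          by (simp add: s_def is_mapD(4)[OF t])
        also have "\<dots> = a (in_left (left_part w)) + a (in_right (right_part w))"
          using w by (simp add: tg tf)
        also have "\<dots> = a w" using is_mapD(4)[OF a tot_in[OF w]] by simp
        finally show ?thesis .
      next
        case False
        then show ?thesis using is_mapD(5)[OF s False] is_mapD(5)[OF a False] t0 by simp
      qed
      then show "t \<circ> s = a" by (simp add: map_eq_iff)
    qed
    then show ?thesis using up[OF T ai aj eq] by metis
  qed
  with * S m s sm show ?thesis by (simp add: cokernel_of_TS map_eq_iff)
qed

lemma pushout_cover:
  assumes sq: "pushout_square TS (Arrow A B f) (Arrow A X g) (Arrow X P f') (Arrow B P g')"
  shows "p \<in> tot P \<Longrightarrow> \<exists>b\<in>tot B. \<exists>x\<in>tot X. p = g' b + f' x"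
    and "p \<in> lft P \<Longrightarrow> \<exists>b\<in>lft B. \<exists>x\<in>lft X. p = g' b + f' x"
    and "p \<in> rgt P \<Longrightarrow> \<exists>b\<in>rgt B. \<exists>x\<in>rgt X. p = g' b + f' x"
proof -
  let ?s = "restr (tot (osum B X)) (\<lambda>w. g' (left_part w) + f' (right_part w))"
  have S: "strict_onto (osum B X) P ?s" and obj: "is_obj B" "is_obj X"
    using pushout_is_cokernel[OF sq] sq by (auto simp: cokernel_of_iff pushout_TS)
  show "p \<in> tot P \<Longrightarrow> \<exists>b\<in>tot B. \<exists>x\<in>tot X. p = g' b + f' x"
    using S by (fastforce simp: strict_onto_def)
  show "p \<in> lft P \<Longrightarrow> \<exists>b\<in>lft B. \<exists>x\<in>lft X. p = g' b + f' x"
    using S is_objD(6)[OF obj(1)] is_objD(6)[OF obj(2)] by (fastforce simp: strict_onto_def)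
  show "p \<in> rgt P \<Longrightarrow> \<exists>b\<in>rgt B. \<exists>x\<in>rgt X. p = g' b + f' x"
    using S is_objD(7)[OF obj(1)] is_objD(7)[OF obj(2)] by (fastforce simp: strict_onto_def)
qed

text \<open>
  The pair \<open>(b, x)\<close> vanishes in the pushout, so it lies in the saturation of the image of \<open>A\<close>
  in the direct sum; the two conclusions are the two conditions in the definition of the
  saturation.
\<close>

lemma pushout_relation:
  assumes sq: "pushout_square TS (Arrow A B f) (Arrow A X g) (Arrow X P f') (Arrow B P g')"
    and bx: "b \<in> tot B" "x \<in> tot X" "g' b = f' x"
  shows "\<exists>a\<in>tot A. \<exists>h\<in>lft B. \<exists>h'\<in>lft X. b = f a + h \<and> x = g a + h'"
    and "\<exists>a\<in>tot A. \<exists>n\<in>rgt B. \<exists>n'\<in>rgt X. b = f a + n \<and> x = g a + n'"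
proof -
  let ?s = "restr (tot (osum B X)) (\<lambda>w. g' (left_part w) + f' (right_part w))"
  let ?w = "in_left b + in_right x"
  let ?m = "\<lambda>a. in_left (f a) + in_right (g a)"
  have "?w \<in> tot (osum B X)" "?s ?w = 0" using bx by auto
  then have w: "?w \<in> saturation (osum B X) (?m ` tot A)"
    using pushout_is_cokernel[OF sq] by (auto simp: cokernel_of_iff)
  have split: "b = f a + left_part h" "x = g a + right_part h" if "?w + h = ?m a" for a h
  proof -
    have "?w = ?m a + h" using that by (metis add.commute vec_add_self_left)
    then have "left_part ?w = left_part (?m a + h)" "right_part ?w = right_part (?m a + h)" by simp_all
    then show "b = f a + left_part h" "x = g a + right_part h" by simp_all
  qed
  show "\<exists>a\<in>tot A. \<exists>h\<in>lft B. \<exists>h'\<in>lft X. b = f a + h \<and> x = g a + h'"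
    using w split unfolding saturation_def by force
  show "\<exists>a\<in>tot A. \<exists>n\<in>rgt B. \<exists>n'\<in>rgt X. b = f a + n \<and> x = g a + n'"
    using w split unfolding saturation_def by force
qed

text \<open>
  When \<open>f\<close> is a kernel, the image of \<open>A\<close> in the direct sum of \<open>B\<close> and \<open>X\<close> is saturated
  already, so the pushout identifies only what \<open>A\<close> forces. Both hypotheses enter: that \<open>f\<close>
  reflects the two subspaces gives injectivity of \<open>f'\<close>, and that its image is saturated puts
  \<open>b\<close> into that image.
\<close>

lemma strict_pushout_relation:
  assumes sq: "pushout_square TS (Arrow A B f) (Arrow A X g) (Arrow X P f') (Arrow B P g')"
    and f: "strict_into A B f" "saturation B (f ` tot A) \<subseteq> f ` tot A"
  shows "x \<in> tot X \<Longrightarrow> f' x = 0 \<Longrightarrow> x = 0"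
    and "b \<in> tot B \<Longrightarrow> x \<in> tot X \<Longrightarrow> g' b = f' x \<Longrightarrow> \<exists>c\<in>tot A. b = f c \<and> x = g c"
proof -
  from sq have *: "is_obj A" "is_obj B" "is_obj X" "is_map A X g" "is_map X P f'" "is_map B P g'"
    and comm: "g' \<circ> f = f' \<circ> g"
    by (auto simp: pushout_TS)
  have comm': "g' (f c) = f' (g c)" for c using comm by (metis comp_apply)
  have refl: "\<And>a. a \<in> tot A \<Longrightarrow> f a \<in> lft B \<Longrightarrow> a \<in> lft A" "\<And>a. a \<in> tot A \<Longrightarrow> f a \<in> rgt B \<Longrightarrow> a \<in> rgt A"
    using f(1) by (auto simp: strict_into_def)
  show inj: "x = 0" if x: "x \<in> tot X" "f' x = 0" for x
  proof -
    have rel: "0 \<in> tot B" "x \<in> tot X" "g' 0 = f' x"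
      using x is_objD(1)[OF *(2)] is_map_zero_vec[OF *(6,2)] by auto
    obtain a h h' where a: "a \<in> tot A" "h \<in> lft B" "h' \<in> lft X" "0 = f a + h" "x = g a + h'"
      using pushout_relation(1)[OF sq rel] by blast
    obtain c n n' where c: "c \<in> tot A" "n \<in> rgt B" "n' \<in> rgt X" "0 = f c + n" "x = g c + n'"
      using pushout_relation(2)[OF sq rel] by blast
    \<comment> \<open>Hence \<open>a\<close> is a left and \<open>c\<close> a right vector, and \<open>x\<close> is both.\<close>
    have "f a = h" "f c = n" using a(4) c(4) by (metis vec_add_eq_0_iff)+
    then have "g a \<in> lft X" "g c \<in> rgt X"
      using is_mapD(2,3)[OF *(4)] refl a c by blast+
    then have "x \<in> lft X" "x \<in> rgt X"
      using subsp_add[OF is_objD(2)[OF *(3)]] subsp_add[OF is_objD(3)[OF *(3)]] a(3,5) c(3,5) by metis+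
    then show ?thesis by (rule is_objD(8)[OF *(3)])
  qed
  show "\<exists>c\<in>tot A. b = f c \<and> x = g c" if bx: "b \<in> tot B" "x \<in> tot X" "g' b = f' x"
  proof -
    obtain a h where a: "a \<in> tot A" "h \<in> lft B" "b = f a + h"
      using pushout_relation(1)[OF sq bx] by blast
    obtain c n where c: "c \<in> tot A" "n \<in> rgt B" "b = f c + n"
      using pushout_relation(2)[OF sq bx] by blast
    have "b + h = f a" using a(3) by (simp add: add.assoc)
    moreover have "b + n = f c" using c(3) by (simp add: add.assoc)
    ultimately have "b \<in> saturation B (f ` tot A)"
      using a(1,2) c(1,2) unfolding saturation_def by blast
    then obtain d where d: "d \<in> tot A" "b = f d" using f(2) by blast
    then have gd: "g d \<in> tot X" "f' x = f' (g d)" using is_mapD(1)[OF *(4)] bx(3) comm' by auto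
    then have "f' (x + g d) = 0" using is_map_eq_iff[OF *(3,5)] bx(2) by blast
    then have "x + g d = 0" using inj gd(1) bx(2) is_objD(1)[OF *(3)] by blast
    then show ?thesis using d by (auto simp: vec_add_eq_0_iff)
  qed
qed

text \<open>
  The conditions of \<open>is_kernel_iff\<close> pass from \<open>f\<close> to \<open>f'\<close>: each element of \<open>P\<close> is represented
  by a pair from \<open>B\<close> and \<open>X\<close> (\<open>pushout_cover\<close>), two representations differ by an element of
  \<open>A\<close>, and \<open>f\<close> returns the statement about \<open>B\<close> to one about \<open>A\<close>, which \<open>g\<close> carries to \<open>X\<close>.
\<close>

lemma kernel_pushout_TS:
  assumes "is_kernel TS a" "pushout_square TS a b a' b'"
  shows "is_kernel TS a'"
proof -
  obtain A B f A' X g X' P f' B' P' g'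
    where arr: "a = Arrow A B f" "b = Arrow A' X g" "a' = Arrow X' P f'" "b' = Arrow B' P' g'"
    by (metis arr.exhaust)
  have eqs: "A' = A" "X' = X" "P' = P" "B' = B"
    using assms(2) unfolding arr pushout_TS by auto
  note sq = assms(2)[unfolded arr eqs]
  from sq have *: "is_obj A" "is_obj B" "is_obj X" "is_obj P" "is_map A X g" "is_map X P f'" "is_map B P g'"
    and comm: "g' \<circ> f = f' \<circ> g"
    by (auto simp: pushout_TS)
  have comm': "g' (f c) = f' (g c)" for c using comm by (metis comp_apply)
  have f: "strict_into A B f" "saturation B (f ` tot A) \<subseteq> f ` tot A"
    using assms(1) by (auto simp: arr is_kernel_iff)
  have refl: "\<And>a. a \<in> tot A \<Longrightarrow> f a \<in> lft B \<Longrightarrow> a \<in> lft A" "\<And>a. a \<in> tot A \<Longrightarrow> f a \<in> rgt B \<Longrightarrow> a \<in> rgt A"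
    using f(1) by (auto simp: strict_into_def)
  note inj = strict_pushout_relation(1)[OF sq f] and rel = strict_pushout_relation(2)[OF sq f]
  note B_sub = is_objD(6,7)[OF *(2)] and X_sub = is_objD(6,7)[OF *(3)]
  note add_X = subsp_add[OF is_objD(1)[OF *(3)]] and f'_add = is_mapD(4)[OF *(6)]
  \<comment> \<open>If \<open>f' x\<close> is the image of a pair \<open>(b, y)\<close>, then \<open>(b, x + y)\<close> comes from \<open>A\<close>.\<close>
  have shift: "\<exists>c\<in>tot A. b = f c \<and> x + y = g c"
    if "b \<in> tot B" "x \<in> tot X" "y \<in> tot X" "f' x = g' b + f' y" for b x y
  proof (rule rel)
    have "g' b = f' x + f' y" using that(4) by (simp add: add.assoc)
    then show "g' b = f' (x + y)" using f'_add that by simp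
  qed (use that add_X in auto)
  have "strict_into X P f'"
    unfolding strict_into_def
  proof (intro conjI ballI impI *(6))
    fix x assume x: "x \<in> tot X"
    show "x = 0" if "f' x = 0" using inj x that .
    show "x \<in> lft X" if fx: "f' x \<in> lft P"
    proof -
      obtain b y where bdy: "b \<in> lft B" "y \<in> lft X" "f' x = g' b + f' y"
        using pushout_cover(2)[OF sq fx] by blast
      then obtain c where c: "c \<in> tot A" "b = f c" "x + y = g c" using shift x B_sub X_sub by blast
      then have "x + y \<in> lft X" using refl(1) bdy(1) is_mapD(2)[OF *(5)] by metis
      then show ?thesis using subsp_add_cancel_right[OF is_objD(2)[OF *(3)] bdy(2)] by blast
    qed
    show "x \<in> rgt X" if fx: "f' x \<in> rgt P"
    proof -
      obtain b y where bdy: "b \<in> rgt B" "y \<in> rgt X" "f' x = g' b + f' y"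
        using pushout_cover(3)[OF sq fx] by blast
      then obtain c where c: "c \<in> tot A" "b = f c" "x + y = g c" using shift x B_sub X_sub by blast
      then have "x + y \<in> rgt X" using refl(2) bdy(1) is_mapD(3)[OF *(5)] by metis
      then show ?thesis using subsp_add_cancel_right[OF is_objD(3)[OF *(3)] bdy(2)] by blast
    qed
  qed
  moreover have "p \<in> f' ` tot X" if p: "p \<in> saturation P (f' ` tot X)" for p
  proof -
    obtain h n x z where hn: "h \<in> lft P" "n \<in> rgt P" "x \<in> tot X" "z \<in> tot X" "p + h = f' x" "p + n = f' z"
      using p unfolding saturation_def by blast
    obtain b y where b: "b \<in> lft B" "y \<in> lft X" "h = g' b + f' y"
      using pushout_cover(2)[OF sq hn(1)] by blast
    obtain e w where e: "e \<in> rgt B" "w \<in> rgt X" "n = g' e + f' w"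
      using pushout_cover(3)[OF sq hn(2)] by blast
    have tots: "b \<in> tot B" "e \<in> tot B" "y \<in> tot X" "w \<in> tot X" using b e B_sub X_sub by blast+
    have "f' x + f' z = h + n"
      using hn(5,6) by (metis add.assoc add.commute vec_add_self_left)
    then have "f' (x + z) = g' (b + e) + f' (y + w)"
      using f'_add tots hn(3,4) by (simp add: is_mapD(4)[OF *(7)] b(3) e(3) ac_simps)
    then obtain c where c: "c \<in> tot A" "b + e = f c"
      using shift[of "b + e" "x + z" "y + w"] tots hn(3,4) add_X subsp_add[OF is_objD(1)[OF *(2)]] by blast
    \<comment> \<open>So \<open>b\<close>, which is a left vector, equals the right vector \<open>e\<close> modulo the image of \<open>f\<close>.\<close>
    have "b + b \<in> f ` tot A"
      using subsp_zero[OF image_tot(1)[OF *(1), of B f]] f(1) by (simp add: strict_into_def)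
    then have "b \<in> saturation B (f ` tot A)"
      using b(1) e(1) c unfolding saturation_def by blast
    then obtain d where d: "d \<in> tot A" "b = f d" using f(2) by blast
    have gd: "g d \<in> tot X" using is_mapD(1)[OF *(5) d(1)] .
    have "p = h + f' x" using hn(5) by (metis add.commute vec_add_self_left)
    also have "\<dots> = f' (g d + y + x)"
      using f'_add gd tots hn(3) add_X by (simp add: b(3) d(2) comm')
    finally show ?thesis using gd tots hn(3) add_X by blast
  qed
  ultimately show ?thesis using *(3,4) by (auto simp: arr eqs is_kernel_iff)
qed

theorem quasi_abelian_TS: "quasi_abelian_category TS"
  using preabelian_TS cokernel_pullback_TS kernel_pushout_TS
  by (auto intro!: quasi_abelian_category.intro quasi_abelian_category_axioms.intro)

section \<open>A monomorphism with a zero pushout\<close>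

abbreviation "bare \<equiv> line False False"
abbreviation "left_line \<equiv> line True False"
abbreviation "right_line \<equiv> line False True"

text \<open>
  Glueing a left line and a right line along their underlying line yields a line whose
  generator is both left and right. It must vanish, so the pushout is zero and the
  monomorphism into the left line becomes the map from the right line to zero.
\<close>

lemma mono_with_zero_pushout:
  "mono_arr TS (Arrow bare left_line (point gen))"
  "pushout_square TS (Arrow bare left_line (point gen)) (Arrow bare right_line (point gen))
     (Arrow right_line zobj (\<lambda>_. 0)) (Arrow left_line zobj (\<lambda>_. 0))"
  "\<not> mono_arr TS (Arrow right_line zobj (\<lambda>_. 0))"
proof -
  have objs: "is_obj bare" "is_obj left_line" "is_obj right_line" by (simp_all add: is_obj_line)
  have maps: "is_map bare left_line (point gen)" "is_map bare right_line (point gen)"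
    using is_map_point[of left_line gen False False] is_map_point[of right_line gen False False] objs by simp_all
  show "mono_arr TS (Arrow bare left_line (point gen))"
    using objs maps by (simp add: mono_TS_iff)
  show "\<not> mono_arr TS (Arrow right_line zobj (\<lambda>_. 0))"
    by (simp add: mono_TS_iff)
  have "\<exists>!t. is_map zobj T t \<and> t \<circ> (\<lambda>_. 0) = a \<and> t \<circ> (\<lambda>_. 0) = b"
    if T: "is_obj T" and a: "is_map left_line T a" and b: "is_map right_line T b"
      and eq: "a \<circ> point gen = b \<circ> point gen" for T a b
  proof -
    have "a gen = b gen" using eq by (metis comp_apply point_simps(1))
    \<comment> \<open>The common image of the generator is in both subspaces of \<open>T\<close>.\<close>
    then have "a gen = 0" "b gen = 0"
      using is_mapD(2)[OF a, of gen] is_mapD(3)[OF b, of gen] is_objD(8)[OF T] by auto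
    then have "a v = 0" "b v = 0" for v
      using is_mapD(5)[OF a, of v] is_mapD(5)[OF b, of v] is_map_zero_vec[OF a objs(2)] is_map_zero_vec[OF b objs(3)]
      by auto
    then have "a = (\<lambda>_. 0)" "b = (\<lambda>_. 0)" by (auto simp: map_eq_iff)
    then show ?thesis using T by (auto simp: is_map_zobj map_eq_iff)
  qed
  then show "pushout_square TS (Arrow bare left_line (point gen)) (Arrow bare right_line (point gen))
     (Arrow right_line zobj (\<lambda>_. 0)) (Arrow left_line zobj (\<lambda>_. 0))"
    using objs maps by (simp add: pushout_TS is_map_zobj map_eq_iff)
qed

section \<open>A universal monomorphism that is not strict\<close>

text \<open>
  The plane with its two coordinate axes, and the inclusion of the diagonal line.
\<close>

abbreviation "cross \<equiv> osum left_line right_line"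
abbreviation "diagonal \<equiv> Arrow bare cross (point (in_left gen + in_right gen))"

lemma diagonal_map:
  "is_obj bare" "is_obj cross" "is_map bare cross (point (in_left gen + in_right gen))"
proof -
  show objs: "is_obj bare" "is_obj cross" by (simp_all add: is_obj_line is_obj_osum)
  show "is_map bare cross (point (in_left gen + in_right gen))"
    by (rule is_map_point[OF objs(2)]) simp_all
qed

text \<open>
  Pushing out along a map that sends the generator to \<open>x\<close> adjoins to \<open>X\<close> a decomposition of
  \<open>x\<close> into a left and a right vector. If \<open>x\<close> has such a decomposition in \<open>X\<close>, it is unique and
  the new one is identified with it; otherwise nothing is identified. Either way \<open>X\<close> embeds.
  For a vector \<open>x\<close> of \<open>X\<close> that dies, the pair \<open>(0, x)\<close> is the sum of a left pair and the image
  of a multiple of the generator, and likewise for a right pair. The first component of that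
  image is a multiple of the diagonal vector that lies on an axis, so the multiple is zero,
  and \<open>x\<close> itself is both left and right.
\<close>

lemma universal_mono_diagonal: "universal_mono TS diagonal"
  unfolding universal_mono_def
proof (intro conjI allI impI)
  have neq: "in_left gen + in_right gen \<noteq> 0"
    by (metis gen_neq_0(1) parts_additive(1,5) parts_of_embeddings(1,3) add.right_neutral)
  then show "mono_arr TS diagonal"
    using diagonal_map by (simp add: mono_TS_iff)
  fix b a' b' assume square: "pushout_square TS diagonal b a' b'"
  obtain A' X g X' P f' B' P' g'
    where arr: "b = Arrow A' X g" "a' = Arrow X' P f'" "b' = Arrow B' P' g'"
    by (metis arr.exhaust)
  have eqs: "A' = bare" "X' = X" "P' = P" "B' = cross"
    using square unfolding arr pushout_TS by auto
  note sq = square[unfolded arr eqs]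
  from sq have *: "is_obj X" "is_obj P" "is_map bare X g" "is_map X P f'" "is_map cross P g'"
    by (auto simp: pushout_TS)
  have g0: "g 0 = 0" using is_map_zero_vec[OF *(3) diagonal_map(1)] .
  have "x = 0" if x: "x \<in> tot X" "f' x = 0" for x
  proof -
    have rel: "0 \<in> tot cross" "x \<in> tot X" "g' 0 = f' x"
      using x is_map_zero_vec[OF *(5) diagonal_map(2)] by auto
    obtain c h h' where c: "c \<in> tot bare" "h \<in> lft cross" "h' \<in> lft X"
      "0 = point (in_left gen + in_right gen) c + h" "x = g c + h'"
      using pushout_relation(1)[OF sq rel] by blast
    obtain d n n' where d: "d \<in> tot bare" "n \<in> rgt cross" "n' \<in> rgt X"
      "0 = point (in_left gen + in_right gen) d + n" "x = g d + n'"
      using pushout_relation(2)[OF sq rel] by blast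
    \<comment> \<open>The diagonal vector lies in neither axis.\<close>
    have "in_left gen + in_right gen \<notin> lft cross" "in_left gen + in_right gen \<notin> rgt cross" by simp_all
    moreover have "point (in_left gen + in_right gen) c = h" "point (in_left gen + in_right gen) d = n"
      using c(4) d(4) by (metis vec_add_eq_0_iff)+
    ultimately have "c = 0" "d = 0" using c(1,2) d(1,2) by (auto simp del: in_osum)
    then have "x \<in> lft X" "x \<in> rgt X" using c d g0 by simp_all
    then show ?thesis by (rule is_objD(8)[OF *(1)])
  qed
  with * show "mono_arr TS a'" by (simp add: arr eqs mono_TS_iff)
qed

lemma iso_TS_onto:
  assumes "iso_arr TS (Arrow X Y f)"
  shows "tot Y \<subseteq> f ` tot X"
proof
  fix y assume y: "y \<in> tot Y"
  obtain g where g: "is_map Y X g" "f \<circ> g = restr (tot Y) id"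
    using assms by (auto simp: iso_arr_def Hom_TS)
  have "f (g y) = y" using g(2) y by (metis comp_apply restr_in id_apply)
  then show "y \<in> f ` tot X" using is_mapD(1)[OF g(1) y] by force
qed

text \<open>
  The plane is the sum of an axis and the diagonal, for either axis, so the saturation of the
  diagonal is the whole plane. The cokernel is therefore zero and the image is the plane; if
  the comparison map were an isomorphism, the diagonal inclusion would hit the basis vector
  \<open>in_left gen\<close>.
\<close>

lemma not_strict_diagonal: "\<not> strict_arr TS diagonal"
proof
  assume "strict_arr TS diagonal"
  then obtain u e m where e: "coimage_of TS e diagonal" and m: "image_of TS m diagonal"
    and u: "u \<in> Hom TS (Cod TS e) (Dom TS m)" "iso_arr TS u" and fac: "diagonal = m \<cdot>\<^bsub>TS\<^esub> (u \<cdot>\<^bsub>TS\<^esub> e)"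
    by (auto simp: strict_arr_def comparison_of_def)
  obtain E F ef M N mf U V uf
    where arr: "e = Arrow E F ef" "m = Arrow M N mf" "u = Arrow U V uf"
    by (metis arr.exhaust)
  have "is_cokernel TS e" using e by (auto simp: coimage_of_def is_cokernel_def)
  then have e_onto: "tot F \<subseteq> ef ` tot E" by (simp add: arr is_cokernel_iff strict_onto_def)
  have u_onto: "tot V \<subseteq> uf ` tot U" using u(2) iso_TS_onto by (simp add: arr)
  have ends: "U = F" "V = M" "E = bare" "N = cross"
    and fac': "point (in_left gen + in_right gen) = mf \<circ> (uf \<circ> ef)"
    using u(1) fac by (auto simp: arr)
  obtain c where c: "cokernel_of TS c diagonal" "kernel_of TS m c"
    using m by (auto simp: image_of_def)
  obtain Y Q q where cq: "c = Arrow Y Q q" by (metis arr.exhaust)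
  have "q v = 0 \<longleftrightarrow> v \<in> saturation cross (point (in_left gen + in_right gen) ` tot bare)"
    if "v \<in> tot cross" for v
    using c(1) that by (simp add: cq cokernel_of_iff)
  moreover have "mf ` tot M = {v\<in>tot cross. q v = 0}"
    using c(2) ends(4) by (simp add: cq arr kernel_of_iff)
  moreover have "in_left gen \<in> saturation cross (point (in_left gen + in_right gen) ` tot bare)"
  proof -
    have "in_left gen \<in> lft cross" "in_right gen \<in> rgt cross"
      "in_left gen + in_left gen \<in> point (in_left gen + in_right gen) ` tot bare"
      "in_left gen + in_right gen \<in> point (in_left gen + in_right gen) ` tot bare"
      by (simp_all add: image_iff)
    then show ?thesis unfolding saturation_def by blast
  qed
  moreover have "in_left gen \<in> tot cross" by simp
  ultimately obtain w where w: "w \<in> tot M" "in_left gen = mf w" by blast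
  then obtain z where "z \<in> tot bare" "w = uf (ef z)" using u_onto e_onto ends by blast
  then have "in_left gen = point (in_left gen + in_right gen) z" using w fac' by (metis comp_apply)
  then have "in_left gen = in_left gen + in_right gen \<or> in_left gen = 0" by (simp add: point_def split: if_splits)
  then show False
    by (metis gen_neq_0(1) parts_additive(1,2,5,6) parts_of_embeddings add.left_neutral)
qed

section \<open>Renaming objects and morphisms\<close>

text \<open>
  Objects and morphisms of a category can be renamed along injections without changing any
  categorical property. The renamed category has exactly the new names as objects and
  morphisms, so that quantifiers over its homsets translate back (\<open>quantifiers_relabel\<close>), and
  with them each definition.
\<close>

definition relabel :: "('o \<Rightarrow> 'p) \<Rightarrow> ('m \<Rightarrow> 'n) \<Rightarrow> ('o, 'm) addcat \<Rightarrow> ('p, 'n) addcat" where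
  "relabel \<phi> \<psi> C = \<lparr>
     Ob = \<phi> ` Ob C,
     Arr = \<psi> ` Arr C,
     Dom = (\<lambda>a. \<phi> (Dom C (inv_into UNIV \<psi> a))),
     Cod = (\<lambda>a. \<phi> (Cod C (inv_into UNIV \<psi> a))),
     Id = (\<lambda>x. \<psi> (Id C (inv_into UNIV \<phi> x))),
     Comp = (\<lambda>b a. \<psi> (Comp C (inv_into UNIV \<psi> b) (inv_into UNIV \<psi> a))),
     Plus = (\<lambda>a b. \<psi> (Plus C (inv_into UNIV \<psi> a) (inv_into UNIV \<psi> b))),
     Zero = (\<lambda>x y. \<psi> (Zero C (inv_into UNIV \<phi> x) (inv_into UNIV \<phi> y)))\<rparr>"

lemma ex1_bounded: "(\<exists>!a. a \<in> A \<and> P a) \<longleftrightarrow> (\<exists>a\<in>A. P a \<and> (\<forall>b\<in>A. P b \<longrightarrow> b = a))"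
  by blast

locale relabelling =
  fixes \<phi> :: "'o \<Rightarrow> 'p" and \<psi> :: "'m \<Rightarrow> 'n" and C :: "('o, 'm) addcat"
  assumes inj_ob: "inj \<phi>" and inj_arr: "inj \<psi>"
begin

abbreviation R :: "('p, 'n) addcat" where "R \<equiv> relabel \<phi> \<psi> C"

lemma inj_simps [simp]: "\<phi> X = \<phi> Y \<longleftrightarrow> X = Y" "\<psi> f = \<psi> g \<longleftrightarrow> f = g"
  using inj_ob inj_arr by (auto dest: injD)

lemma relabel_simps [simp]:
  "\<phi> X \<in> Ob R \<longleftrightarrow> X \<in> Ob C" "\<psi> f \<in> Arr R \<longleftrightarrow> f \<in> Arr C"
  "Dom R (\<psi> f) = \<phi> (Dom C f)" "Cod R (\<psi> f) = \<phi> (Cod C f)" "Id R (\<phi> X) = \<psi> (Id C X)"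
  "Comp R (\<psi> g) (\<psi> f) = \<psi> (Comp C g f)" "Plus R (\<psi> f) (\<psi> g) = \<psi> (Plus C f g)"
  "Zero R (\<phi> X) (\<phi> Y) = \<psi> (Zero C X Y)"
  using inj_ob inj_arr by (auto simp: relabel_def image_iff)

lemma Hom_relabel [simp]: "\<psi> f \<in> Hom R (\<phi> X) (\<phi> Y) \<longleftrightarrow> f \<in> Hom C X Y"
  by (auto simp: Hom_def)

lemma Hom_relabelE:
  assumes "a \<in> Hom R x y"
  obtains f X Y where "a = \<psi> f" "x = \<phi> X" "y = \<phi> Y" "f \<in> Hom C X Y"
proof -
  have "a \<in> \<psi> ` Arr C" using assms by (auto simp: Hom_def relabel_def)
  then obtain f where f: "a = \<psi> f" "f \<in> Arr C" by blast
  then have "x = \<phi> (Dom C f)" "y = \<phi> (Cod C f)" "f \<in> Hom C (Dom C f) (Cod C f)"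
    using assms by (auto simp: Hom_def)
  with f(1) show thesis by (rule that)
qed

lemma Arr_relabelE:
  assumes "a \<in> Arr R"
  obtains f where "a = \<psi> f" "f \<in> Arr C"
  using assms by (auto simp: relabel_def)

lemma Hom_relabel_image: "Hom R (\<phi> X) (\<phi> Y) = \<psi> ` Hom C X Y"
  by (auto elim!: Hom_relabelE)

lemma quantifiers_relabel [simp]:
  "(\<forall>x\<in>Ob R. P x) \<longleftrightarrow> (\<forall>X\<in>Ob C. P (\<phi> X))"
  "(\<exists>x\<in>Ob R. P x) \<longleftrightarrow> (\<exists>X\<in>Ob C. P (\<phi> X))"
  "(\<forall>a\<in>Hom R (\<phi> X) (\<phi> Y). Q a) \<longleftrightarrow> (\<forall>f\<in>Hom C X Y. Q (\<psi> f))"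
  "(\<exists>a\<in>Hom R (\<phi> X) (\<phi> Y). Q a) \<longleftrightarrow> (\<exists>f\<in>Hom C X Y. Q (\<psi> f))"
  by (auto simp: Hom_relabel_image) (auto simp: relabel_def)

lemma ex1_Hom_relabel [simp]:
  "(\<exists>!a. a \<in> Hom R (\<phi> X) (\<phi> Y) \<and> Q a) \<longleftrightarrow> (\<exists>!f. f \<in> Hom C X Y \<and> Q (\<psi> f))"
  "(\<exists>!a. a \<in> Hom R (\<phi> X) (\<phi> Y)) \<longleftrightarrow> (\<exists>!f. f \<in> Hom C X Y)"
proof -
  show Q: "(\<exists>!a. a \<in> Hom R (\<phi> X) (\<phi> Y) \<and> Q a) \<longleftrightarrow> (\<exists>!f. f \<in> Hom C X Y \<and> Q (\<psi> f))" for Q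
    by (simp add: ex1_bounded Hom_relabel_image)
  show "(\<exists>!a. a \<in> Hom R (\<phi> X) (\<phi> Y)) \<longleftrightarrow> (\<exists>!f. f \<in> Hom C X Y)"
    using Q[of "\<lambda>_. True"] by simp
qed

lemma mono_relabel [simp]: "mono_arr R (\<psi> f) \<longleftrightarrow> mono_arr C f"
proof -
  have "(\<forall>t. \<forall>u\<in>Hom R t (\<phi> X). \<forall>v\<in>Hom R t (\<phi> X). P u v) \<longleftrightarrow>
    (\<forall>T. \<forall>u\<in>Hom C T X. \<forall>v\<in>Hom C T X. P (\<psi> u) (\<psi> v))" for X P
    by (auto elim!: Hom_relabelE) (metis Hom_relabel)
  then show ?thesis by (simp add: mono_arr_def)
qed

lemma iso_relabel [simp]: "iso_arr R (\<psi> f) \<longleftrightarrow> iso_arr C f"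
  by (simp add: iso_arr_def)

lemma pullback_relabel [simp]:
  "pullback_square R (\<psi> f) (\<psi> g) (\<psi> f') (\<psi> g') \<longleftrightarrow> pullback_square C f g f' g'"
  by (simp add: pullback_square_def)

lemma pushout_relabel [simp]:
  "pushout_square R (\<psi> f) (\<psi> g) (\<psi> f') (\<psi> g') \<longleftrightarrow> pushout_square C f g f' g'"
  by (simp add: pushout_square_def)

lemma pullback_relabelE:
  assumes "pullback_square R a b a' b'"
  obtains f g f' g' where "a = \<psi> f" "b = \<psi> g" "a' = \<psi> f'" "b' = \<psi> g'" "pullback_square C f g f' g'"
proof -
  have "a \<in> Arr R" "b \<in> Arr R" "a' \<in> Arr R" "b' \<in> Arr R"
    using assms by (auto simp: pullback_square_def Hom_def)
  with that assms show thesis by (auto elim!: Arr_relabelE)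
qed

lemma pushout_relabelE:
  assumes "pushout_square R a b a' b'"
  obtains f g f' g' where "a = \<psi> f" "b = \<psi> g" "a' = \<psi> f'" "b' = \<psi> g'" "pushout_square C f g f' g'"
proof -
  have "a \<in> Arr R" "b \<in> Arr R" "a' \<in> Arr R" "b' \<in> Arr R"
    using assms by (auto simp: pushout_square_def Hom_def)
  with that assms show thesis by (auto elim!: Arr_relabelE)
qed

lemma kernel_of_relabel [simp]: "kernel_of R (\<psi> k) (\<psi> f) \<longleftrightarrow> kernel_of C k f"
  by (simp add: kernel_of_def)

lemma cokernel_of_relabel [simp]: "cokernel_of R (\<psi> c) (\<psi> f) \<longleftrightarrow> cokernel_of C c f"
  by (simp add: cokernel_of_def)

lemma kernel_of_relabelE:
  assumes "kernel_of R a b"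
  obtains k f where "a = \<psi> k" "b = \<psi> f" "kernel_of C k f"
proof -
  have "a \<in> Arr R" "b \<in> Arr R"
    using assms by (auto simp: kernel_of_def Hom_def)
  with that assms show thesis by (auto elim!: Arr_relabelE)
qed

lemma cokernel_of_relabelE:
  assumes "cokernel_of R a b"
  obtains c f where "a = \<psi> c" "b = \<psi> f" "cokernel_of C c f"
proof -
  have "a \<in> Arr R" "b \<in> Arr R"
    using assms by (auto simp: cokernel_of_def Hom_def)
  with that assms show thesis by (auto elim!: Arr_relabelE)
qed

lemma is_kernel_relabel [simp]: "is_kernel R (\<psi> k) \<longleftrightarrow> is_kernel C k"
  unfolding is_kernel_def by (metis kernel_of_relabel kernel_of_relabelE inj_simps(2))

lemma is_cokernel_relabel [simp]: "is_cokernel R (\<psi> c) \<longleftrightarrow> is_cokernel C c"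
  unfolding is_cokernel_def by (metis cokernel_of_relabel cokernel_of_relabelE inj_simps(2))

lemma universal_mono_relabel: "universal_mono C f \<Longrightarrow> universal_mono R (\<psi> f)"
  by (auto simp: universal_mono_def elim!: pushout_relabelE) blast

lemma strict_relabel: "strict_arr R (\<psi> f) \<Longrightarrow> strict_arr C f"
proof -
  assume "strict_arr R (\<psi> f)"
  then obtain u e m where *: "coimage_of R e (\<psi> f)" "image_of R m (\<psi> f)"
    "u \<in> Hom R (Cod R e) (Dom R m)" "\<psi> f = m \<cdot>\<^bsub>R\<^esub> (u \<cdot>\<^bsub>R\<^esub> e)" "iso_arr R u"
    by (auto simp: strict_arr_def comparison_of_def)
  obtain e' where e: "e = \<psi> e'" "coimage_of C e' f"
    using *(1) unfolding coimage_of_def by (metis cokernel_of_relabelE kernel_of_relabelE inj_simps(2))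
  obtain m' where m: "m = \<psi> m'" "image_of C m' f"
    using *(2) unfolding image_of_def by (metis cokernel_of_relabelE kernel_of_relabelE inj_simps(2))
  obtain u' where u: "u = \<psi> u'" using *(3) by (rule Hom_relabelE)
  show ?thesis
    using * e m u unfolding strict_arr_def comparison_of_def by auto
qed

lemma category_relabel: "category C \<Longrightarrow> category R"
proof -
  assume "category C"
  then interpret category C .
  show ?thesis
  proof
    show "Dom R a \<in> Ob R" "Cod R a \<in> Ob R" if "a \<in> Arr R" for a
      using that by (auto elim!: Arr_relabelE intro: Dom_Ob Cod_Ob)
    show "Id R x \<in> Hom R x x" if "x \<in> Ob R" for x
    proof -
      obtain X where "x = \<phi> X" "X \<in> Ob C" using \<open>x \<in> Ob R\<close> by (auto simp: relabel_def)
      then show ?thesis using Id_Hom by simp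
    qed
  qed (auto elim!: Hom_relabelE simp: Comp_Id Id_Comp intro: Comp_Hom Comp_assoc)
qed

text \<open>
  The renamed homsets are commutative groups as homomorphic images.
\<close>

lemma preadditive_relabel: "preadditive_category C \<Longrightarrow> preadditive_category R"
proof -
  assume "preadditive_category C"
  then interpret preadditive_category C .
  show ?thesis
  proof (intro preadditive_category.intro preadditive_category_axioms.intro category_relabel category_axioms)
    fix x y assume "x \<in> Ob R" "y \<in> Ob R"
    then obtain X Y where xy: "x = \<phi> X" "y = \<phi> Y" "X \<in> Ob C" "Y \<in> Ob C" by (auto simp: relabel_def)
    interpret G: comm_group "\<lparr>carrier = Hom C X Y, mult = Plus C, one = Zero C X Y\<rparr>"
      using Hom_group xy by blast
    have "\<psi> \<in> hom \<lparr>carrier = Hom C X Y, mult = Plus C, one = Zero C X Y\<rparr>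
        \<lparr>carrier = UNIV, mult = Plus R, one = Zero R x y\<rparr>"
      by (simp add: hom_def)
    from G.hom_imp_img_comm_group[OF this]
    show "comm_group \<lparr>carrier = Hom R x y, mult = Plus R, one = Zero R x y\<rparr>"
      by (simp add: xy Hom_relabel_image)
  qed (auto elim!: Hom_relabelE simp: Comp_Plus Plus_Comp)
qed

lemma additive_relabel: "additive_category C \<Longrightarrow> additive_category R"
proof -
  assume "additive_category C"
  then interpret additive_category C .
  show ?thesis
  proof (intro additive_category.intro additive_category_axioms.intro preadditive_relabel preadditive_category_axioms)
    obtain N where "zero_object C N" using ex_zero_object by blast
    then have "zero_object R (\<phi> N)" by (simp add: zero_object_def)
    then show "\<exists>N. zero_object R N" by blast
    fix x y assume "x \<in> Ob R" "y \<in> Ob R"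
    then obtain X Y where xy: "x = \<phi> X" "y = \<phi> Y" "X \<in> Ob C" "Y \<in> Ob C" by (auto simp: relabel_def)
    obtain S i j p q where "biproduct C X Y S i j p q" using ex_biproduct[OF xy(3,4)] by blast
    then have "biproduct R x y (\<phi> S) (\<psi> i) (\<psi> j) (\<psi> p) (\<psi> q)" by (simp add: biproduct_def xy)
    then show "\<exists>S i j p q. biproduct R x y S i j p q" by blast
  qed
qed

lemma preabelian_relabel: "preabelian_category C \<Longrightarrow> preabelian_category R"
proof -
  assume "preabelian_category C"
  then interpret preabelian_category C .
  show ?thesis
  proof (intro preabelian_category.intro preabelian_category_axioms.intro additive_relabel additive_category_axioms)
    fix a assume "a \<in> Arr R"
    then obtain f where f: "a = \<psi> f" "f \<in> Arr C" by (rule Arr_relabelE)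
    show "\<exists>k. kernel_of R k a" "\<exists>c. cokernel_of R c a"
      using ex_kernel[OF f(2)] ex_cokernel[OF f(2)] f(1) by (metis kernel_of_relabel cokernel_of_relabel)+
  qed
qed

lemma quasi_abelian_relabel: "quasi_abelian_category C \<Longrightarrow> quasi_abelian_category R"
proof -
  assume "quasi_abelian_category C"
  then interpret quasi_abelian_category C .
  show ?thesis
  proof (intro quasi_abelian_category.intro quasi_abelian_category_axioms.intro preabelian_relabel preabelian_category_axioms)
    show "is_cokernel R a'" if "is_cokernel R a" "pullback_square R a b a' b'" for a b a' b'
      using that cokernel_pullback by (auto elim!: pullback_relabelE)
    show "is_kernel R a'" if "is_kernel R a" "pushout_square R a b a' b'" for a b a' b'
      using that kernel_pushout by (auto elim!: pushout_relabelE)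
  qed
qed

end

section \<open>Names for bit sequences, objects and morphisms\<close>

text \<open>
  A pair of sets of vectors is recorded as a single one, their disjoint union: the odd
  entries, zero or \<open>gen\<close>, serve as a tag.
\<close>

definition join :: "vec set \<Rightarrow> vec set \<Rightarrow> vec set" where
  "join A B = in_left ` A \<union> (\<lambda>v. in_left v + in_right gen) ` B"

lemma join_inject: "join A B = join A' B' \<longleftrightarrow> A = A' \<and> B = B'"
proof -
  have left: "in_left u = in_left v \<longleftrightarrow> u = v" for u v by (metis parts_of_embeddings(1))
  have apart: "in_left u \<noteq> in_left v + in_right gen" for u v
  proof
    assume "in_left u = in_left v + in_right gen"
    then have "right_part (in_left u) = right_part (in_left v + in_right gen)" by simp
    then show False by simp
  qed
  have "A = {u. in_left u \<in> join A B}" "B = {u. in_left u + in_right gen \<in> join A B}" for A B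
    using apart apart[symmetric] by (auto simp: join_def left)
  then show ?thesis by metis
qed

definition graph :: "(vec \<Rightarrow> vec) \<Rightarrow> vec set" where
  "graph f = range (\<lambda>v. in_left v + in_right (f v))"

lemma graph_inject: "graph f = graph g \<longleftrightarrow> f = g"
proof -
  have "in_left v + in_right w \<in> graph f \<longleftrightarrow> w = f v" for v w f
  proof
    assume "in_left v + in_right w \<in> graph f"
    then obtain u where u: "in_left v + in_right w = in_left u + in_right (f u)" by (auto simp: graph_def)
    then have "left_part (in_left v + in_right w) = left_part (in_left u + in_right (f u))"
      "right_part (in_left v + in_right w) = right_part (in_left u + in_right (f u))" by simp_all
    then show "w = f v" by simp
  qed (auto simp: graph_def)
  then show ?thesis by (metis ext)
qed

text \<open>
  A sequence of bits is named by its support, as a set of reals, and a set of sequences by the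
  set of these names.
\<close>

definition name_set :: "vec set \<Rightarrow> label" where
  "name_set A = (\<lambda>v. real ` {n. v n = 1}) ` A"

lemma inj_name_set: "inj name_set"
proof -
  have "inj (\<lambda>v :: vec. real ` {n. v n = 1})"
  proof (rule injI)
    fix u v :: vec assume "real ` {n. u n = 1} = real ` {n. v n = 1}"
    then have "{n. u n = 1} = {n. v n = 1}" by (simp add: inj_image_eq_iff inj_of_nat)
    then have "u n = 1 \<longleftrightarrow> v n = 1" for n by blast
    then show "u = v" by (metis bit_not_one_iff ext)
  qed
  then show ?thesis by (simp add: name_set_def inj_image_eq_iff inj_def)
qed

definition obj_set :: "obj \<Rightarrow> vec set" where
  "obj_set X = join (tot X) (join (lft X) (rgt X))"

definition arr_set :: "arr \<Rightarrow> vec set" where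
  "arr_set a = join (obj_set (src a)) (join (obj_set (tgt a)) (graph (fn a)))"

lemma inj_obj_set: "inj obj_set"
  by (auto intro!: injI obj.expand simp: obj_set_def join_inject)

lemma inj_arr_set: "inj arr_set"
  by (auto intro!: injI arr.expand simp: arr_set_def join_inject graph_inject inj_eq[OF inj_obj_set])

lemma label_names: "inj (name_set \<circ> obj_set)" "inj (name_set \<circ> arr_set)"
  using inj_name_set inj_obj_set inj_arr_set by (auto intro: inj_compose)

theorem proposition3p1:
  "\<exists>C :: (label, label) addcat.
     quasi_abelian_category C \<and> \<not> integral_category C \<and>
     (\<exists>f. universal_mono C f \<and> \<not> strict_arr C f)"
proof -
  interpret relabelling "name_set \<circ> obj_set" "name_set \<circ> arr_set" TS
    using label_names by unfold_locales
  have "\<not> integral_category R"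
    using mono_with_zero_pushout integral_category.mono_pushout[of R] by (metis mono_relabel pushout_relabel)
  moreover have "quasi_abelian_category R"
    using quasi_abelian_TS by (rule quasi_abelian_relabel)
  ultimately show ?thesis
    using universal_mono_relabel[OF universal_mono_diagonal] strict_relabel not_strict_diagonal by blast
qed

end
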